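(* The categories $\mathsf{MoSL}$ (modal semilattices and modal homomorphisms) and $\mathsf{MoSsp}$ (MoS-spaces and compatible meet-relations) are dually equivalent, i.e. $\mathsf{MoSL}^{op}$ is equivalent to $\mathsf{MoSsp}$.
   Context: **$\mathsf{MoSL}$.** A semilattice is a meet-semilattice with greatest element $\mathbf{A}=\langle A,\wedge,1\rangle$; homomorphisms preserve $\wedge$ and $1$. A modal semilattice is $\langle\mathbf{A},d\rangle$ with $\mathbf{A}$ a semilattice and $d:A\to A$ satisfying $d(1)=1$ and $d(a\wedge b)=d(a)\wedge d(b)$. A modal homomorphism $h:\langle\mathbf{A},d\rangle\to\langle\mathbf{B},n\rangle$ is a semilattice homomorphism with $h(d(a))=n(h(a))$ for all $a\in A$. **S-spaces.** Let $X$ be a set and $\mathcal{K}\subseteq\mathcal{P}(X)$, regarded as a subbase of a topology on $X$. Put $S(X)=\{U^c: U\in\mathcal{K}\}$ and $\mathcal{C}_{\mathcal{K}}(X)=\{\bigcap\mathcal{A}:\mathcal{A}\subseteq S(X)\}$ (with $\bigcap\emptyset=X$). For $Y\subseteq X$, a family $\mathcal{J}\subseteq S(X)$ is a $Y$-family if for all $A,B\in\mathcal{J}$ there are $H\in S(X)$, $C\in\mathcal{J}$ with $Y\subseteq H$, $A\cap H\subseteq C$ and $B\cap H\subseteq C$. $\langle X,\mathcal{K}\rangle$ is an S-space if: (S1) the topology is $T_0$ and $X=\bigcup\mathcal{K}$; (S2) $\mathcal{K}$ is a subbase of compact open sets, closed under finite unions, and $\emptyset\in\mathcal{K}$; (S3)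 if $x\in U\cap V$ with $U,V\in\mathcal{K}$, there are $W,D\in\mathcal{K}$ with $x\notin W$, $x\in D$, $D\subseteq(U\cap V)\cup W$; (S4) if $Y\in\mathcal{C}_{\mathcal{K}}(X)$ and $\mathcal{J}\subseteq S(X)$ is a $Y$-family with $Y\cap A^c\neq\emptyset$ for all $A\in\mathcal{J}$, then $Y\cap\bigcap\{A^c:A\in\mathcal{J}\}\neq\emptyset$. Put $\mathrm{cl}_{\mathcal{K}}(x)=\bigcap\{U\in S(X):x\in U\}$. The dual specialization order is: $x\sqsupseteq y$ iff $y\in\mathrm{cl}_{\mathcal{K}}(x)$. **Meet-relations.** For $T\subseteq X\times Y$ write $T(x)=\{y:(x,y)\in T\}$ and $\Box_T(U)=\{x\in X:T(x)\subseteq U\}$. A meet-relation between S-spaces $\langle X_1,\mathcal{K}_1\rangle$ and $\langle X_2,\mathcal{K}_2\rangle$ is $T\subseteq X_1\times X_2$ such that $\Box_T(U)\in S(X_1)$ for all $U\in S(X_2)$, and $T(x)=\bigcap\{U\in S(X_2):T(x)\subseteq U\}$ for all $x\in X_1$. For meet-relations $R\subseteq X_1\times X_2$, $T\subseteq X_2\times X_3$, the composition is $T*R=\{(x,z)\in X_1\times X_3:\forall U\in S(X_3)\,((T\circ R)(x)\subseteq U\Rightarrow z\in U)\}$, where $(T\circ R)(x)=\bigcup_{y\in R(x)}T(y)$. **$\mathsf{MoSsp}$.** A MoS-space is $\langle X,\mathcal{K},T\rangle$ with $\langle X,\mathcal{K}\rangle$ an S-space and $T\subseteq X\times X$ a meet-relation.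 A meet-relation $M\subseteq X\times Y$ between MoS-spaces $\langle X,\mathcal{K}_X,T_1\rangle$ and $\langle Y,\mathcal{K}_Y,T_2\rangle$ is compatible if $M*T_1=T_2*M$. $\mathsf{MoSsp}$ has MoS-spaces as objects, compatible meet-relations as morphisms, composition $*$, and identities $\sqsupseteq_X$.
   Formalization: In (S4) the Y-family is required to be nonempty: as written, the empty set as Y with the empty Y-family would make (S4) demand that the empty set be nonempty, so no S-space would exist and the duality would fail. *)

theory Defs
  imports "HOL-Analysis.Analysis" "HOL-Library.Equipollence"
begin

section \<open>Categories\<close>

text \<open>
  Hom-sets of different pairs of objects need not be disjoint (the same relation can be a morphism
  between many spaces), so composition and functors take the objects as arguments:
  \<open>Comp C A B D g f\<close> is the composite of \<open>f : A \<rightarrow> B\<close> and \<open>g : B \<rightarrow> D\<close>.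
\<close>

record ('o, 'm) cat =
  Obj :: "'o set"
  Hom :: "'o \<Rightarrow> 'o \<Rightarrow> 'm set"
  Comp :: "'o \<Rightarrow> 'o \<Rightarrow> 'o \<Rightarrow> 'm \<Rightarrow> 'm \<Rightarrow> 'm"
  Ident :: "'o \<Rightarrow> 'm"

locale category =
  fixes C :: "('o, 'm) cat"
  assumes Ident_in_Hom: "A \<in> Obj C \<Longrightarrow> Ident C A \<in> Hom C A A"
    and Comp_in_Hom:
      "\<lbrakk>A \<in> Obj C; B \<in> Obj C; D \<in> Obj C; f \<in> Hom C A B; g \<in> Hom C B D\<rbrakk>
        \<Longrightarrow> Comp C A B D g f \<in> Hom C A D"
    and Comp_Ident_right:
      "\<lbrakk>A \<in> Obj C; B \<in> Obj C; f \<in> Hom C A B\<rbrakk> \<Longrightarrow> Comp C A A B f (Ident C A) = f"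
    and Comp_Ident_left:
      "\<lbrakk>A \<in> Obj C; B \<in> Obj C; f \<in> Hom C A B\<rbrakk> \<Longrightarrow> Comp C A B B (Ident C B) f = f"
    and Comp_assoc:
      "\<lbrakk>A \<in> Obj C; B \<in> Obj C; D \<in> Obj C; E \<in> Obj C;
        f \<in> Hom C A B; g \<in> Hom C B D; h \<in> Hom C D E\<rbrakk>
        \<Longrightarrow> Comp C A D E h (Comp C A B D g f) = Comp C A B E (Comp C B D E h g) f"

definition op_cat :: "('o, 'm) cat \<Rightarrow> ('o, 'm) cat" where
  "op_cat C = \<lparr>Obj = Obj C, Hom = (\<lambda>A B. Hom C B A),
     Comp = (\<lambda>A B D g f. Comp C D B A f g), Ident = Ident C\<rparr>"

locale cat_functor =
  fixes C :: "('o, 'm) cat" and D :: "('p, 'n) cat"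
    and Fo :: "'o \<Rightarrow> 'p" and Fm :: "'o \<Rightarrow> 'o \<Rightarrow> 'm \<Rightarrow> 'n"
  assumes Fo_Obj: "A \<in> Obj C \<Longrightarrow> Fo A \<in> Obj D"
    and Fm_Hom: "\<lbrakk>A \<in> Obj C; B \<in> Obj C; f \<in> Hom C A B\<rbrakk> \<Longrightarrow> Fm A B f \<in> Hom D (Fo A) (Fo B)"
    and Fm_Ident: "A \<in> Obj C \<Longrightarrow> Fm A A (Ident C A) = Ident D (Fo A)"
    and Fm_Comp:
      "\<lbrakk>A \<in> Obj C; B \<in> Obj C; E \<in> Obj C; f \<in> Hom C A B; g \<in> Hom C B E\<rbrakk>
        \<Longrightarrow> Fm A E (Comp C A B E g f) = Comp D (Fo A) (Fo B) (Fo E) (Fm B E g) (Fm A B f)"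

definition cat_iso :: "('o, 'm) cat \<Rightarrow> 'o \<Rightarrow> 'o \<Rightarrow> 'm \<Rightarrow> bool" where
  "cat_iso C A B f \<longleftrightarrow> f \<in> Hom C A B \<and>
     (\<exists>g \<in> Hom C B A. Comp C A B A g f = Ident C A \<and> Comp C B A B f g = Ident C B)"

locale natural_iso =
  fixes C :: "('o, 'm) cat" and D :: "('p, 'n) cat"
    and Fo :: "'o \<Rightarrow> 'p" and Fm :: "'o \<Rightarrow> 'o \<Rightarrow> 'm \<Rightarrow> 'n"
    and Go :: "'o \<Rightarrow> 'p" and Gm :: "'o \<Rightarrow> 'o \<Rightarrow> 'm \<Rightarrow> 'n"
    and \<eta> :: "'o \<Rightarrow> 'n"
  assumes component_iso: "A \<in> Obj C \<Longrightarrow> cat_iso D (Fo A) (Go A) (\<eta> A)"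
    and naturality:
      "\<lbrakk>A \<in> Obj C; B \<in> Obj C; f \<in> Hom C A B\<rbrakk>
        \<Longrightarrow> Comp D (Fo A) (Fo B) (Go B) (\<eta> B) (Fm A B f)
          = Comp D (Fo A) (Go A) (Go B) (Gm A B f) (\<eta> A)"

definition equivalent_cats :: "('o, 'm) cat \<Rightarrow> ('p, 'n) cat \<Rightarrow> bool" where
  "equivalent_cats C D \<longleftrightarrow> category C \<and> category D \<and>
     (\<exists>Fo Fm Go Gm \<eta> \<epsilon>.
        cat_functor C D Fo Fm \<and> cat_functor D C Go Gm \<and>
        natural_iso C C (\<lambda>A. A) (\<lambda>A B f. f) (\<lambda>A. Go (Fo A)) (\<lambda>A B f. Gm (Fo A) (Fo B) (Fm A B f)) \<eta> \<and>
        natural_iso D D (\<lambda>X. Fo (Go X)) (\<lambda>X Y g. Fm (Go X) (Go Y) (Gm X Y g)) (\<lambda>X. X) (\<lambda>X Y g. g) \<epsilon>)"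

definition dually_equivalent :: "('o, 'm) cat \<Rightarrow> ('p, 'n) cat \<Rightarrow> bool" where
  "dually_equivalent C D \<longleftrightarrow> category C \<and> equivalent_cats (op_cat C) D"


section \<open>Modal semilattices\<close>

record 'a mod_sl =
  carr :: "'a set"
  meet :: "'a \<Rightarrow> 'a \<Rightarrow> 'a"
  one :: "'a"
  dia :: "'a \<Rightarrow> 'a"

definition semilattice1 :: "'a mod_sl \<Rightarrow> bool" where
  "semilattice1 L \<longleftrightarrow>
     one L \<in> carr L \<and>
     (\<forall>a\<in>carr L. \<forall>b\<in>carr L. meet L a b \<in> carr L) \<and>
     (\<forall>a\<in>carr L. \<forall>b\<in>carr L. \<forall>c\<in>carr L. meet L (meet L a b) c = meet L a (meet L b c)) \<and>
     (\<forall>a\<in>carr L. \<forall>b\<in>carr L. meet L a b = meet L b a) \<and>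
     (\<forall>a\<in>carr L. meet L a a = a) \<and>
     (\<forall>a\<in>carr L. meet L a (one L) = a)"

definition modal_semilattice :: "'a mod_sl \<Rightarrow> bool" where
  "modal_semilattice L \<longleftrightarrow> semilattice1 L \<and>
     dia L \<in> carr L \<rightarrow> carr L \<and>
     dia L (one L) = one L \<and>
     (\<forall>a\<in>carr L. \<forall>b\<in>carr L. dia L (meet L a b) = meet L (dia L a) (dia L b))"

text \<open>Homomorphisms are extensional, so that equality of functions is equality of morphisms.\<close>

definition modal_hom :: "'a mod_sl \<Rightarrow> 'b mod_sl \<Rightarrow> ('a \<Rightarrow> 'b) set" where
  "modal_hom L M = {h \<in> carr L \<rightarrow>\<^sub>E carr M.
     h (one L) = one M \<and>
     (\<forall>a\<in>carr L. \<forall>b\<in>carr L. h (meet L a b) = meet M (h a) (h b)) \<and>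
     (\<forall>a\<in>carr L. h (dia L a) = dia M (h a))}"


section \<open>S-spaces\<close>

definition SS :: "'b set \<Rightarrow> 'b set set \<Rightarrow> 'b set set" where
  "SS X K = {X - U | U. U \<in> K}"

text \<open>The intersection with \<open>X\<close> makes the empty intersection equal to \<open>X\<close>.\<close>

definition CK :: "'b set \<Rightarrow> 'b set set \<Rightarrow> 'b set set" where
  "CK X K = {X \<inter> \<Inter>\<A> | \<A>. \<A> \<subseteq> SS X K}"

definition Y_family :: "'b set \<Rightarrow> 'b set set \<Rightarrow> 'b set \<Rightarrow> 'b set set \<Rightarrow> bool" where
  "Y_family X K Y J \<longleftrightarrow> J \<subseteq> SS X K \<and>
     (\<forall>A\<in>J. \<forall>B\<in>J. \<exists>H\<in>SS X K. \<exists>C\<in>J. Y \<subseteq> H \<and> A \<inter> H \<subseteq> C \<and> B \<inter> H \<subseteq> C)"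

text \<open>
  In \<open>S4\<close> the family \<open>J\<close> has to be nonempty: the set \<open>{}\<close> always belongs to \<open>CK X K\<close> because
  \<open>\<Union>K = X\<close>, so for \<open>J = {}\<close> and \<open>Y = {}\<close> the condition would demand that \<open>{}\<close> be nonempty, and
  there would be no S-spaces at all.
\<close>

locale S_space =
  fixes X :: "'b set" and K :: "'b set set"
  assumes K_subsets: "K \<subseteq> Pow X"
    and S1_T0: "t0_space (topology_generated_by K)"
    and S1_cover: "X = \<Union>K"
    and S2_compact: "U \<in> K \<Longrightarrow> compactin (topology_generated_by K) U"
    and S2_union: "\<lbrakk>U \<in> K; V \<in> K\<rbrakk> \<Longrightarrow> U \<union> V \<in> K"
    and S2_empty: "{} \<in> K"
    and S3: "\<lbrakk>U \<in> K; V \<in> K; x \<in> U \<inter> V\<rbrakk>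
      \<Longrightarrow> \<exists>W\<in>K. \<exists>D\<in>K. x \<notin> W \<and> x \<in> D \<and> D \<subseteq> (U \<inter> V) \<union> W"
    and S4: "\<lbrakk>Y \<in> CK X K; Y_family X K Y J; J \<noteq> {}; \<forall>A\<in>J. Y \<inter> (X - A) \<noteq> {}\<rbrakk>
      \<Longrightarrow> Y \<inter> (\<Inter>A\<in>J. X - A) \<noteq> {}"

definition cl_K :: "'b set \<Rightarrow> 'b set set \<Rightarrow> 'b \<Rightarrow> 'b set" where
  "cl_K X K x = \<Inter>{U \<in> SS X K. x \<in> U}"

text \<open>The dual specialization order as a relation: \<open>(x, y)\<close> is in it iff \<open>y\<close> lies below \<open>x\<close>.\<close>

definition dual_spec :: "'b set \<Rightarrow> 'b set set \<Rightarrow> ('b \<times> 'b) set" where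
  "dual_spec X K = {(x, y). x \<in> X \<and> y \<in> X \<and> y \<in> cl_K X K x}"

definition box :: "'b set \<Rightarrow> ('b \<times> 'c) set \<Rightarrow> 'c set \<Rightarrow> 'b set" where
  "box X T U = {x \<in> X. T `` {x} \<subseteq> U}"

definition meet_relation ::
  "'b set \<Rightarrow> 'b set set \<Rightarrow> 'c set \<Rightarrow> 'c set set \<Rightarrow> ('b \<times> 'c) set \<Rightarrow> bool" where
  "meet_relation X\<^sub>1 K\<^sub>1 X\<^sub>2 K\<^sub>2 T \<longleftrightarrow> T \<subseteq> X\<^sub>1 \<times> X\<^sub>2 \<and>
     (\<forall>U\<in>SS X\<^sub>2 K\<^sub>2. box X\<^sub>1 T U \<in> SS X\<^sub>1 K\<^sub>1) \<and>
     (\<forall>x\<in>X\<^sub>1. T `` {x} = \<Inter>{U \<in> SS X\<^sub>2 K\<^sub>2. T `` {x} \<subseteq> U})"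

text \<open>
  \<open>star X\<^sub>1 X\<^sub>3 K\<^sub>3 T R\<close> is \<open>T * R\<close>. The library's \<open>O\<close> composes in diagrammatic order, hence \<open>R O T\<close>.
\<close>

definition star ::
  "'b set \<Rightarrow> 'd set \<Rightarrow> 'd set set \<Rightarrow> ('c \<times> 'd) set \<Rightarrow> ('b \<times> 'c) set \<Rightarrow> ('b \<times> 'd) set" where
  "star X\<^sub>1 X\<^sub>3 K\<^sub>3 T R = {(x, z). x \<in> X\<^sub>1 \<and> z \<in> X\<^sub>3 \<and>
     (\<forall>U\<in>SS X\<^sub>3 K\<^sub>3. (R O T) `` {x} \<subseteq> U \<longrightarrow> z \<in> U)}"

record 'b mos_space =
  pts :: "'b set"
  subbase :: "'b set set"
  rel :: "('b \<times> 'b) set"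

definition MoS_space :: "'b mos_space \<Rightarrow> bool" where
  "MoS_space S \<longleftrightarrow> S_space (pts S) (subbase S) \<and>
     meet_relation (pts S) (subbase S) (pts S) (subbase S) (rel S)"

definition compatible_meet_rel :: "'b mos_space \<Rightarrow> 'c mos_space \<Rightarrow> ('b \<times> 'c) set set" where
  "compatible_meet_rel S S' = {M.
     meet_relation (pts S) (subbase S) (pts S') (subbase S') M \<and>
     star (pts S) (pts S') (subbase S') M (rel S) = star (pts S) (pts S') (subbase S') (rel S') M}"


section \<open>The categories of modal semilattices and of MoS-spaces\<close>

text \<open>
  Both categories are large, so they are formed relative to a class \<open>\<S>\<close> of small sets: the objects
  are the modal semilattices whose carrier is in \<open>\<S>\<close> and the MoS-spaces whose family \<open>SS X K\<close> is
  in bijection with a set in \<open>\<S>\<close>. Since an S-space is \<open>T\<^sub>0\<close>, its points embed into the power set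
  of \<open>SS X K\<close>; hence if \<open>\<S>\<close> is closed under power sets and under passing to sets that
  embed into a member, the latter are exactly the MoS-spaces whose point set is in \<open>\<S>\<close>
  (lemma \<open>Obj_MoSsp_universe\<close> below). No such closure is needed for the definitions: one may take for
  \<open>\<S>\<close> all sets over a type.
\<close>

definition MoSL :: "'a set set \<Rightarrow> ('a mod_sl, 'a \<Rightarrow> 'a) cat" where
  "MoSL \<S> = \<lparr>Obj = {L. modal_semilattice L \<and> carr L \<in> \<S>},
     Hom = modal_hom,
     Comp = (\<lambda>L M N. compose (carr L)),
     Ident = (\<lambda>L. \<lambda>a\<in>carr L. a)\<rparr>"

definition MoSsp :: "'a set set \<Rightarrow> ('b mos_space, ('b \<times> 'b) set) cat" where
  "MoSsp \<S> = \<lparr>Obj = {S. MoS_space S \<and> (\<exists>A\<in>\<S>. SS (pts S) (subbase S) \<approx> A)},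
     Hom = compatible_meet_rel,
     Comp = (\<lambda>S\<^sub>1 S\<^sub>2 S\<^sub>3. star (pts S\<^sub>1) (pts S\<^sub>3) (subbase S\<^sub>3)),
     Ident = (\<lambda>S. dual_spec (pts S) (subbase S))\<rparr>"

lemma S_space_pts_lepoll:
  assumes "S_space X K"
  shows "X \<lesssim> Pow (SS X K)"
proof -
  interpret S_space X K by fact
  have same_open: "(x \<in> U) = (y \<in> U)"
    if xy: "x \<in> X" "y \<in> X" and eq: "{A \<in> SS X K. x \<in> A} = {A \<in> SS X K. y \<in> A}"
      and U: "generate_topology_on K U" for x y U
    using U
  proof induction
    case (Basis U)
    then have "X - U \<in> SS X K"
      unfolding SS_def by auto
    moreover have "(X - U \<in> {A \<in> SS X K. x \<in> A}) = (X - U \<in> {A \<in> SS X K. y \<in> A})"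
      by (simp only: eq)
    ultimately show ?case
      using xy by simp
  next
    case (UN L)
    then show ?case by (simp add: Union_iff cong: bex_cong)
  qed simp_all
  have "inj_on (\<lambda>x. {A \<in> SS X K. x \<in> A}) X"
  proof (rule inj_onI, rule ccontr)
    fix x y
    assume xy: "x \<in> X" "y \<in> X" "{A \<in> SS X K. x \<in> A} = {A \<in> SS X K. y \<in> A}" "x \<noteq> y"
    have "x \<in> topspace (topology_generated_by K)" "y \<in> topspace (topology_generated_by K)"
      using xy(1,2) S1_cover by simp_all
    then obtain U where U: "openin (topology_generated_by K) U" "(x \<in> U) \<noteq> (y \<in> U)"
      using S1_T0[unfolded t0_space_def, rule_format, of x y] xy(4) by (auto simp only: simp_thms)
    show False
      using same_open[OF xy(1-3) openin_topology_generated_by[OF U(1)]] U(2) by simp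
  qed
  moreover have "(\<lambda>x. {A \<in> SS X K. x \<in> A}) ` X \<subseteq> Pow (SS X K)"
    by auto
  ultimately show ?thesis
    unfolding lepoll_def by (intro exI conjI)
qed

lemma Obj_MoSsp_universe:
  fixes \<S> :: "'u set set"
  assumes sub: "\<And>A B. \<lbrakk>A \<in> \<S>; B \<lesssim> A\<rbrakk> \<Longrightarrow> B \<in> \<S>"
    and pow: "\<And>A. A \<in> \<S> \<Longrightarrow> \<exists>B\<in>\<S>. Pow A \<approx> B"
  shows "Obj (MoSsp \<S> :: ('u mos_space, ('u \<times> 'u) set) cat) = {S. MoS_space S \<and> pts S \<in> \<S>}"
proof -
  have "(\<exists>A\<in>\<S>. SS X K \<approx> A) \<longleftrightarrow> X \<in> \<S>" if SK: "S_space X K" for X :: "'u set" and K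
  proof
    assume "\<exists>A\<in>\<S>. SS X K \<approx> A"
    then obtain A where A: "A \<in> \<S>" "SS X K \<approx> A" by blast
    obtain B where B: "B \<in> \<S>" "Pow A \<approx> B" using pow A(1) by blast
    have "X \<lesssim> Pow (SS X K)" using S_space_pts_lepoll[OF SK] .
    also have "Pow (SS X K) \<approx> Pow A"
      using A(2) unfolding eqpoll_def by (elim exE) (rule exI, erule bij_betw_Pow)
    also have "Pow A \<approx> B" by fact
    finally show "X \<in> \<S>" by (rule sub[OF B(1)])
  next
    assume X: "X \<in> \<S>"
    obtain B where B: "B \<in> \<S>" "Pow X \<approx> B" using pow X by blast
    have "SS X K \<lesssim> Pow X"
      by (rule subset_imp_lepoll) (auto simp: SS_def)
    also have "Pow X \<approx> B" by fact
    finally obtain f where f: "inj_on f (SS X K)" "f ` SS X K \<subseteq> B"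
      unfolding lepoll_def by blast
    then have "f ` SS X K \<in> \<S>" by (intro sub[OF B(1)] subset_imp_lepoll)
    moreover have "SS X K \<approx> f ` SS X K"
      by (rule eqpoll_sym[OF inj_on_image_eqpoll_self[OF f(1)]])
    ultimately show "\<exists>A\<in>\<S>. SS X K \<approx> A" by (rule bexI[rotated])
  qed
  then show ?thesis
    unfolding MoSsp_def MoS_space_def by (simp cong: conj_cong)
qed

end

theory Submission
  imports Defs
begin

text \<open>
  The contravariant functor \<open>S \<mapsto> SS X K\<close>, \<open>M \<mapsto> \<box>\<^sub>M\<close> from MoS-spaces to modal semilattices is
  fully faithful and essentially surjective. A meet-relation is determined by its box operator, and
  \<open>*\<close> corresponds to composition of box operators. Conversely, a homomorphism
  \<open>h : SS X\<^sub>2 K\<^sub>2 \<rightarrow> SS X\<^sub>1 K\<^sub>1\<close> is the box operator of \<open>T(x) = \<Inter>{U. x \<in> h U}\<close>, by compactness of the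
  members of \<open>K\<^sub>2\<close>. A modal semilattice is recovered from the space of its irreducible filters:
  \<open>S4\<close> is the separation of filters from relative ideals (Zorn's lemma), \<open>S3\<close> says that the
  filters are irreducible, and compactness follows from separation by Alexander's subbase theorem.
\<close>

section \<open>Equivalences from fully faithful, essentially surjective functors\<close>

text \<open>The shape of the proof is dictated by \<open>*\<close>, which closes up the relational
  composite: associativity and unit laws are awkward for relations, but become laws of function
  composition for box operators. The equations between meet-relations are therefore checked on
  closed subbasic sets only, and compatibility turns into preservation of the modal operator. No
  distributivity is available, so there may be too few prime filters. Irreducible filters take their
  place, and ideals give way to sets that are directed modulo a filter, which is what a
  \<open>Y\<close>-family is in terms of closed sets. The other obstacle is one of types. Points
  have type \<open>'b\<close> and closed sets type \<open>'b set\<close>, while the semilattices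
  have elements of type \<open>'a\<close>; both passages go through chosen injections. No canonical
  inverse functor or counit is written down: they come by choice from full faithfulness and
  essential surjectivity.\<close>

lemma category_op_cat:
  assumes "category C"
  shows "category (op_cat C)"
proof -
  interpret category C by fact
  show ?thesis
    by unfold_locales
      (simp_all add: op_cat_def Ident_in_Hom Comp_in_Hom Comp_Ident_left Comp_Ident_right Comp_assoc)
qed

lemma cat_iso_op_cat: "cat_iso (op_cat C) A B f \<longleftrightarrow> cat_iso C B A f"
  unfolding cat_iso_def op_cat_def by auto

text \<open>The missing functor conjugates: for each \<open>A\<close> an object \<open>F A\<close>
  with an isomorphism \<open>\<eta> A\<close> and its inverse \<open>\<theta> A\<close> is chosen,
  \<open>K A B f\<close> is \<open>f\<close> carried over along them, and the preimage of
  \<open>K A B f\<close> under \<open>Gm\<close> is the value at \<open>f\<close>. Equations in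
  \<open>D\<close> are proved after applying \<open>Gm\<close>, which is injective on each
  hom-set.\<close>

lemma equivalent_cats_if_fully_faithful_ess_surj:
  assumes "category C" and "category D" and G: "cat_functor D C Go Gm"
    and ff: "\<And>X Y. \<lbrakk>X \<in> Obj D; Y \<in> Obj D\<rbrakk> \<Longrightarrow> bij_betw (Gm X Y) (Hom D X Y) (Hom C (Go X) (Go Y))"
    and es: "\<And>A. A \<in> Obj C \<Longrightarrow> \<exists>X\<in>Obj D. \<exists>f. cat_iso C A (Go X) f"
  shows "equivalent_cats C D"
proof -
  interpret C: category C by fact
  interpret D: category D by fact
  interpret G: cat_functor D C Go Gm by fact
  \<comment> \<open>One predicate for object, isomorphism and inverse, so that a single choice fixes
    all three consistently.\<close>
  define P where "P A t \<longleftrightarrow> (case t of (X, f, g) \<Rightarrow> X \<in> Obj D \<and>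
      f \<in> Hom C A (Go X) \<and> g \<in> Hom C (Go X) A \<and>
      Comp C A (Go X) A g f = Ident C A \<and> Comp C (Go X) A (Go X) f g = Ident C (Go X))" for A t
  have "\<forall>A\<in>Obj C. \<exists>t. P A t"
    using es unfolding P_def cat_iso_def by (simp only: split_paired_Ex prod.case) blast
  then obtain t where t: "\<And>A. A \<in> Obj C \<Longrightarrow> P A (t A)" by metis
  define F where "F A = fst (t A)" for A
  define \<eta> where "\<eta> A = fst (snd (t A))" for A
  define \<theta> where "\<theta> A = snd (snd (t A))" for A
  have FD [simp]: "F A \<in> Obj D" and \<eta> [simp]: "\<eta> A \<in> Hom C A (Go (F A))"
    and \<theta> [simp]: "\<theta> A \<in> Hom C (Go (F A)) A"
    and \<theta>\<eta>: "Comp C A (Go (F A)) A (\<theta> A) (\<eta> A) = Ident C A"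
    and \<eta>\<theta>: "Comp C (Go (F A)) A (Go (F A)) (\<eta> A) (\<theta> A) = Ident C (Go (F A))"
    if "A \<in> Obj C" for A
    using t[OF that] unfolding P_def F_def \<eta>_def \<theta>_def by (auto split: prod.splits)
  note [simp] = G.Fo_Obj C.Comp_in_Hom C.Ident_in_Hom D.Ident_in_Hom D.Comp_in_Hom G.Fm_Hom
  define K where "K A B f =
      Comp C (Go (F A)) B (Go (F B)) (\<eta> B) (Comp C (Go (F A)) A B f (\<theta> A))" for A B f
  have K_Hom [simp]: "K A B f \<in> Hom C (Go (F A)) (Go (F B))"
    if "A \<in> Obj C" "B \<in> Obj C" "f \<in> Hom C A B" for A B f
    unfolding K_def using that
    by (intro C.Comp_in_Hom[of _ B] C.Comp_in_Hom[of _ A]) simp_all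
  have K_Ident: "K A A (Ident C A) = Ident C (Go (F A))" if "A \<in> Obj C" for A
    unfolding K_def using that by (simp add: C.Comp_Ident_left \<eta>\<theta>)
  have K_\<eta>: "Comp C A (Go (F A)) (Go (F B)) (K A B f) (\<eta> A) = Comp C A B (Go (F B)) (\<eta> B) f"
    if AB: "A \<in> Obj C" "B \<in> Obj C" and f: "f \<in> Hom C A B" for A B f
  proof -
    have f\<theta>: "Comp C (Go (F A)) A B f (\<theta> A) \<in> Hom C (Go (F A)) B"
      using AB f by (intro C.Comp_in_Hom[of _ A]) simp_all
    have "Comp C A (Go (F A)) (Go (F B)) (K A B f) (\<eta> A) =
        Comp C A B (Go (F B)) (\<eta> B) (Comp C A (Go (F A)) B (Comp C (Go (F A)) A B f (\<theta> A)) (\<eta> A))"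
      unfolding K_def using AB f f\<theta>
      by (intro C.Comp_assoc[symmetric]) simp_all
    also have "Comp C A (Go (F A)) B (Comp C (Go (F A)) A B f (\<theta> A)) (\<eta> A) =
        Comp C A A B f (Comp C A (Go (F A)) A (\<theta> A) (\<eta> A))"
      using AB f by (intro C.Comp_assoc[symmetric]) simp_all
    also have "\<dots> = f"
      using AB f by (simp add: \<theta>\<eta> C.Comp_Ident_right)
    finally show ?thesis .
  qed
  have \<theta>_K: "Comp C (Go (F A)) (Go (F B)) B (\<theta> B) (K A B f) = Comp C (Go (F A)) A B f (\<theta> A)"
    if AB: "A \<in> Obj C" "B \<in> Obj C" and f: "f \<in> Hom C A B" for A B f
  proof -
    have f\<theta>: "Comp C (Go (F A)) A B f (\<theta> A) \<in> Hom C (Go (F A)) B"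
      using AB f by (intro C.Comp_in_Hom[of _ A]) simp_all
    have "Comp C (Go (F A)) (Go (F B)) B (\<theta> B) (K A B f) =
      Comp C (Go (F A)) B B (Comp C B (Go (F B)) B (\<theta> B) (\<eta> B)) (Comp C (Go (F A)) A B f (\<theta> A))"
      unfolding K_def using AB f f\<theta> by (intro C.Comp_assoc) simp_all
    also have "\<dots> = Comp C (Go (F A)) A B f (\<theta> A)"
      using AB f\<theta> by (simp add: \<theta>\<eta> C.Comp_Ident_left)
    finally show ?thesis .
  qed
  have K_Comp: "K A E (Comp C A B E g f) =
      Comp C (Go (F A)) (Go (F B)) (Go (F E)) (K B E g) (K A B f)"
    if ABE: "A \<in> Obj C" "B \<in> Obj C" "E \<in> Obj C" and f: "f \<in> Hom C A B" and g: "g \<in> Hom C B E"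
    for A B E f g
  proof -
    have g\<theta>: "Comp C (Go (F B)) B E g (\<theta> B) \<in> Hom C (Go (F B)) E"
      using ABE g by (intro C.Comp_in_Hom[of _ B]) simp_all
    have "Comp C (Go (F A)) (Go (F B)) (Go (F E)) (K B E g) (K A B f) =
      Comp C (Go (F A)) E (Go (F E)) (\<eta> E)
        (Comp C (Go (F A)) (Go (F B)) E (Comp C (Go (F B)) B E g (\<theta> B)) (K A B f))"
      unfolding K_def[of B] using ABE f g g\<theta> by (intro C.Comp_assoc[symmetric]) simp_all
    also have "Comp C (Go (F A)) (Go (F B)) E (Comp C (Go (F B)) B E g (\<theta> B)) (K A B f) =
      Comp C (Go (F A)) B E g (Comp C (Go (F A)) (Go (F B)) B (\<theta> B) (K A B f))"
      using ABE f g by (intro C.Comp_assoc[symmetric]) simp_all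
    also have "\<dots> = Comp C (Go (F A)) B E g (Comp C (Go (F A)) A B f (\<theta> A))"
      using ABE f by (simp add: \<theta>_K)
    also have "\<dots> = Comp C (Go (F A)) A E (Comp C A B E g f) (\<theta> A)"
      using ABE f g by (intro C.Comp_assoc) simp_all
    finally show ?thesis unfolding K_def[of A] by simp
  qed
  define L where "L X Y = inv_into (Hom D X Y) (Gm X Y)" for X Y
  have L_Hom [simp]: "L X Y f \<in> Hom D X Y" and G_L [simp]: "Gm X Y (L X Y f) = f"
    if "X \<in> Obj D" "Y \<in> Obj D" "f \<in> Hom C (Go X) (Go Y)" for X Y f
    using bij_betw_imp_surj_on[OF ff[OF that(1,2)]] that(3)
    unfolding L_def by (auto intro: inv_into_into f_inv_into_f)
  have G_eqI: "g = h"
    if "Gm X Y g = Gm X Y h" "X \<in> Obj D" "Y \<in> Obj D" "g \<in> Hom D X Y" "h \<in> Hom D X Y" for X Y g h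
    using bij_betw_imp_inj_on[OF ff[OF that(2,3)]] that by (auto dest: inj_onD)
  define Fm where "Fm A B f = L (F A) (F B) (K A B f)" for A B f
  have F: "cat_functor C D F Fm"
  proof
    show "Fm A A (Ident C A) = Ident D (F A)" if "A \<in> Obj C" for A
      using that by (intro G_eqI[of "F A" "F A"]) (simp_all add: Fm_def K_Ident G.Fm_Ident)
    show "Fm A E (Comp C A B E g f) = Comp D (F A) (F B) (F E) (Fm B E g) (Fm A B f)"
      if ABE: "A \<in> Obj C" "B \<in> Obj C" "E \<in> Obj C" and f: "f \<in> Hom C A B" and g: "g \<in> Hom C B E"
      for A B E f g
    proof (rule G_eqI)
      have gf: "Comp C A B E g f \<in> Hom C A E"
        using ABE f g by (rule C.Comp_in_Hom)
      have fm: "Fm A B f \<in> Hom D (F A) (F B)" "Fm B E g \<in> Hom D (F B) (F E)"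
        using ABE f g by (simp_all add: Fm_def)
      show "Fm A E (Comp C A B E g f) \<in> Hom D (F A) (F E)"
        using ABE gf by (simp add: Fm_def)
      show "Comp D (F A) (F B) (F E) (Fm B E g) (Fm A B f) \<in> Hom D (F A) (F E)"
        using ABE fm by (intro D.Comp_in_Hom) simp_all
      show "Gm (F A) (F E) (Fm A E (Comp C A B E g f)) =
          Gm (F A) (F E) (Comp D (F A) (F B) (F E) (Fm B E g) (Fm A B f))"
        using ABE f g fm gf by (simp add: G.Fm_Comp) (simp add: Fm_def K_Comp)
    qed (use ABE in simp_all)
  qed (simp_all add: Fm_def)
  have nat\<eta>: "natural_iso C C (\<lambda>A. A) (\<lambda>A B f. f) (\<lambda>A. Go (F A)) (\<lambda>A B f. Gm (F A) (F B) (Fm A B f)) \<eta>"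
  proof
    show "cat_iso C A (Go (F A)) (\<eta> A)" if "A \<in> Obj C" for A
      using that \<theta>\<eta>[OF that] \<eta>\<theta>[OF that] \<theta>[OF that] unfolding cat_iso_def by auto
    show "Comp C A B (Go (F B)) (\<eta> B) f =
        Comp C A (Go (F A)) (Go (F B)) (Gm (F A) (F B) (Fm A B f)) (\<eta> A)"
      if "A \<in> Obj C" "B \<in> Obj C" "f \<in> Hom C A B" for A B f
      using that by (simp add: Fm_def K_\<eta>)
  qed
  \<comment> \<open>The counit is the preimage of \<open>\<theta> (Go X)\<close> under
    \<open>Gm\<close>; the preimage of \<open>\<eta> (Go X)\<close> will be its inverse.\<close>
  define \<epsilon> where "\<epsilon> X = L (F (Go X)) X (\<theta> (Go X))" for X
  have \<epsilon>_Hom [simp]: "\<epsilon> X \<in> Hom D (F (Go X)) X"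
    and G_\<epsilon> [simp]: "Gm (F (Go X)) X (\<epsilon> X) = \<theta> (Go X)" if "X \<in> Obj D" for X
    using that by (simp_all add: \<epsilon>_def)
  have nat\<epsilon>: "natural_iso D D (\<lambda>X. F (Go X)) (\<lambda>X Y g. Fm (Go X) (Go Y) (Gm X Y g)) (\<lambda>X. X) (\<lambda>X Y g. g) \<epsilon>"
  proof
    show "cat_iso D (F (Go X)) X (\<epsilon> X)" if X: "X \<in> Obj D" for X
    proof -
      define \<delta> where "\<delta> = L X (F (Go X)) (\<eta> (Go X))"
      have \<delta>: "\<delta> \<in> Hom D X (F (Go X))" "Gm X (F (Go X)) \<delta> = \<eta> (Go X)"
        using X by (simp_all add: \<delta>_def)
      have "Comp D (F (Go X)) X (F (Go X)) \<delta> (\<epsilon> X) = Ident D (F (Go X))"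
        using X \<delta> D.Comp_in_Hom[of "F (Go X)" X "F (Go X)" "\<epsilon> X" \<delta>]
        by (intro G_eqI[of "F (Go X)" "F (Go X)"]) (simp_all add: G.Fm_Comp G.Fm_Ident \<eta>\<theta>)
      moreover have "Comp D X (F (Go X)) X (\<epsilon> X) \<delta> = Ident D X"
        using X \<delta> D.Comp_in_Hom[of X "F (Go X)" X \<delta> "\<epsilon> X"]
        by (intro G_eqI[of X X]) (simp_all add: G.Fm_Comp G.Fm_Ident \<theta>\<eta>)
      ultimately show ?thesis
        using X \<delta> unfolding cat_iso_def by auto
    qed
    show "Comp D (F (Go X)) (F (Go Y)) Y (\<epsilon> Y) (Fm (Go X) (Go Y) (Gm X Y g)) =
        Comp D (F (Go X)) X Y g (\<epsilon> X)"
      if XY: "X \<in> Obj D" "Y \<in> Obj D" and g: "g \<in> Hom D X Y" for X Y g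
    proof (rule G_eqI)
      have Fg: "Fm (Go X) (Go Y) (Gm X Y g) \<in> Hom D (F (Go X)) (F (Go Y))"
        using XY g by (simp add: Fm_def)
      show "Comp D (F (Go X)) (F (Go Y)) Y (\<epsilon> Y) (Fm (Go X) (Go Y) (Gm X Y g)) \<in> Hom D (F (Go X)) Y"
        using XY Fg by (intro D.Comp_in_Hom[of _ "F (Go Y)"]) simp_all
      show "Comp D (F (Go X)) X Y g (\<epsilon> X) \<in> Hom D (F (Go X)) Y"
        using XY g by (intro D.Comp_in_Hom[of _ X]) simp_all
      show "Gm (F (Go X)) Y (Comp D (F (Go X)) (F (Go Y)) Y (\<epsilon> Y) (Fm (Go X) (Go Y) (Gm X Y g))) =
          Gm (F (Go X)) Y (Comp D (F (Go X)) X Y g (\<epsilon> X))"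
        using XY g Fg by (simp add: G.Fm_Comp) (simp add: Fm_def \<theta>_K)
    qed (use XY in simp_all)
  qed
  show ?thesis
    unfolding equivalent_cats_def using \<open>category C\<close> \<open>category D\<close> F G nat\<eta> nat\<epsilon> by blast
qed

section \<open>Meet-relations and the maps they induce on closed subbasic sets\<close>

lemma (in S_space) SS_subset: "U \<in> SS X K \<Longrightarrow> U \<subseteq> X"
  unfolding SS_def by auto

lemma (in S_space) carrier_in_SS: "X \<in> SS X K"
  unfolding SS_def using S2_empty Diff_empty[of X, symmetric] by blast

lemma (in S_space) SS_Int: "\<lbrakk>U \<in> SS X K; V \<in> SS X K\<rbrakk> \<Longrightarrow> U \<inter> V \<in> SS X K"
  unfolding SS_def using S2_union Diff_Un[of X, symmetric] by (auto simp only: mem_Collect_eq)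

lemma Inter_in_if_Int_closed:
  assumes "finite \<G>" "\<G> \<noteq> {}" "\<G> \<subseteq> \<F>" and "\<And>U V. \<lbrakk>U \<in> \<F>; V \<in> \<F>\<rbrakk> \<Longrightarrow> U \<inter> V \<in> \<F>"
  shows "\<Inter>\<G> \<in> \<F>"
  using assms(1-3) by (induction rule: finite_ne_induct) (auto intro: assms(4))

text \<open>The complement of \<open>A\<close> is compact and covered by the complements of the
  members of \<open>\<F>\<close>. Intersecting the members that belong to a finite subcover gives a
  set in \<open>\<F>\<close> contained in \<open>A\<close>.\<close>

lemma (in S_space) filter_base_Inter_subset:
  assumes \<F>: "\<F> \<subseteq> SS X K" "\<F> \<noteq> {}" and Int: "\<And>U V. \<lbrakk>U \<in> \<F>; V \<in> \<F>\<rbrakk> \<Longrightarrow> U \<inter> V \<in> \<F>"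
    and A: "A \<in> SS X K" "\<Inter>\<F> \<subseteq> A"
  shows "\<exists>V\<in>\<F>. V \<subseteq> A"
proof -
  obtain U where U: "U \<in> K" "A = X - U" using A(1) unfolding SS_def by auto
  have "X - V \<in> K" if V: "V \<in> \<F>" for V
  proof -
    obtain W where "V = X - W" "W \<in> K" using V \<F>(1) unfolding SS_def by blast
    then show ?thesis using K_subsets double_diff[of W X X] by auto
  qed
  moreover have "U \<subseteq> (\<Union>V\<in>\<F>. X - V)"
    using A(2) \<F>(2) U K_subsets by auto
  ultimately have "\<exists>\<G>. finite \<G> \<and> \<G> \<subseteq> (\<lambda>V. X - V) ` \<F> \<and> U \<subseteq> \<Union>\<G>"
    by (intro compactinD[OF S2_compact[OF U(1)]]) (auto intro: topology_generated_by_Basis)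
  then obtain \<G> where \<G>: "finite \<G>" "\<G> \<subseteq> \<F>" "U \<subseteq> (\<Union>V\<in>\<G>. X - V)"
    by (metis (no_types, lifting) finite_subset_image)
  show ?thesis
  \<comment> \<open>An empty subcover forces \<open>A = X\<close>, and any member of
    \<open>\<F>\<close> will do. The case is kept apart because \<open>\<Inter>{}\<close> is the
    whole type.\<close>
  proof (cases "\<G> = {}")
    case True
    then show ?thesis using \<F> \<G>(3) U SS_subset by fastforce
  next
    case False
    then have "\<Inter>\<G> \<in> \<F>" using \<G> Int by (intro Inter_in_if_Int_closed) auto
    moreover have "\<Inter>\<G> \<subseteq> X" using False \<G>(2) \<F>(1) SS_subset by blast
    ultimately show ?thesis using \<G>(3) U(2) by (intro bexI[of _ "\<Inter>\<G>"]) auto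
  qed
qed

section \<open>Box operators and the composition of meet-relations\<close>

lemma box_Int: "box X T (U \<inter> V) = box X T U \<inter> box X T V"
  unfolding box_def by auto

lemma box_in_SS: "\<lbrakk>meet_relation X\<^sub>1 K\<^sub>1 X\<^sub>2 K\<^sub>2 T; U \<in> SS X\<^sub>2 K\<^sub>2\<rbrakk> \<Longrightarrow> box X\<^sub>1 T U \<in> SS X\<^sub>1 K\<^sub>1"
  unfolding meet_relation_def by auto

lemma box_carrier: "meet_relation X\<^sub>1 K\<^sub>1 X\<^sub>2 K\<^sub>2 T \<Longrightarrow> box X\<^sub>1 T X\<^sub>2 = X\<^sub>1"
  unfolding meet_relation_def box_def by auto

text \<open>The closure condition on a meet-relation makes \<open>T(x)\<close> the intersection of
  those \<open>U\<close> whose box contains \<open>x\<close>, so passing to the box operator loses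
  nothing.\<close>

lemma meet_relation_eqI:
  assumes T: "meet_relation X\<^sub>1 K\<^sub>1 X\<^sub>2 K\<^sub>2 T" and T': "meet_relation X\<^sub>1 K\<^sub>1 X\<^sub>2 K\<^sub>2 T'"
    and eq: "\<And>U. U \<in> SS X\<^sub>2 K\<^sub>2 \<Longrightarrow> box X\<^sub>1 T U = box X\<^sub>1 T' U"
  shows "T = T'"
proof -
  have "T `` {x} = T' `` {x}" if "x \<in> X\<^sub>1" for x
  proof -
    have "{U \<in> SS X\<^sub>2 K\<^sub>2. T `` {x} \<subseteq> U} = {U \<in> SS X\<^sub>2 K\<^sub>2. T' `` {x} \<subseteq> U}"
      using eq that unfolding box_def by auto
    moreover have "T `` {x} = \<Inter>{U \<in> SS X\<^sub>2 K\<^sub>2. T `` {x} \<subseteq> U}"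
        "T' `` {x} = \<Inter>{U \<in> SS X\<^sub>2 K\<^sub>2. T' `` {x} \<subseteq> U}"
      using T T' that unfolding meet_relation_def by blast+
    ultimately show ?thesis by argo
  qed
  moreover have "T \<subseteq> X\<^sub>1 \<times> X\<^sub>2" "T' \<subseteq> X\<^sub>1 \<times> X\<^sub>2"
    using T T' unfolding meet_relation_def by auto
  ultimately show ?thesis by auto
qed

text \<open>\<open>star\<close> enlarges \<open>(R O T)(x)\<close> only up to the intersection of
  the closed subbasic sets around it, so containment in such a set \<open>U\<close> is unaffected.
  For the plain composite, containment in \<open>U\<close> means that \<open>R(x)\<close> lies in
  the box of \<open>U\<close> under \<open>T\<close>.\<close>

lemma box_star:
  assumes T: "meet_relation X\<^sub>2 K\<^sub>2 X\<^sub>3 K\<^sub>3 T" and R: "meet_relation X\<^sub>1 K\<^sub>1 X\<^sub>2 K\<^sub>2 R"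
    and U: "U \<in> SS X\<^sub>3 K\<^sub>3"
  shows "box X\<^sub>1 (star X\<^sub>1 X\<^sub>3 K\<^sub>3 T R) U = box X\<^sub>1 R (box X\<^sub>2 T U)"
proof -
  have TR: "T \<subseteq> X\<^sub>2 \<times> X\<^sub>3" "R \<subseteq> X\<^sub>1 \<times> X\<^sub>2"
    using T R unfolding meet_relation_def by auto
  have "star X\<^sub>1 X\<^sub>3 K\<^sub>3 T R `` {x} \<subseteq> U \<longleftrightarrow> (R O T) `` {x} \<subseteq> U" if "x \<in> X\<^sub>1" for x
    using TR U that unfolding star_def by blast
  moreover have "(R O T) `` {x} \<subseteq> U \<longleftrightarrow> R `` {x} \<subseteq> box X\<^sub>2 T U" if "x \<in> X\<^sub>1" for x
    using TR unfolding box_def by blast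
  ultimately show ?thesis unfolding box_def[of X\<^sub>1] by auto
qed

lemma meet_relation_star:
  assumes "S_space X\<^sub>3 K\<^sub>3"
    and T: "meet_relation X\<^sub>2 K\<^sub>2 X\<^sub>3 K\<^sub>3 T" and R: "meet_relation X\<^sub>1 K\<^sub>1 X\<^sub>2 K\<^sub>2 R"
  shows "meet_relation X\<^sub>1 K\<^sub>1 X\<^sub>3 K\<^sub>3 (star X\<^sub>1 X\<^sub>3 K\<^sub>3 T R)"
proof -
  interpret S_space X\<^sub>3 K\<^sub>3 by fact
  have TR: "T \<subseteq> X\<^sub>2 \<times> X\<^sub>3" "R \<subseteq> X\<^sub>1 \<times> X\<^sub>2"
    using T R unfolding meet_relation_def by auto
  show ?thesis
    unfolding meet_relation_def
  proof (intro conjI ballI)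
    show "star X\<^sub>1 X\<^sub>3 K\<^sub>3 T R \<subseteq> X\<^sub>1 \<times> X\<^sub>3" unfolding star_def by auto
    show "box X\<^sub>1 (star X\<^sub>1 X\<^sub>3 K\<^sub>3 T R) U \<in> SS X\<^sub>1 K\<^sub>1" if "U \<in> SS X\<^sub>3 K\<^sub>3" for U
      using that by (simp add: box_star[OF T R] box_in_SS[OF R] box_in_SS[OF T])
    fix x assume x: "x \<in> X\<^sub>1"
    \<comment> \<open>\<open>X\<^sub>3\<close> is one of the sets that are intersected, so the
      condition \<open>z \<in> X\<^sub>3\<close> in \<open>star\<close> is absorbed by the
      intersection.\<close>
    have X3: "X\<^sub>3 \<in> {U \<in> SS X\<^sub>3 K\<^sub>3. (R O T) `` {x} \<subseteq> U}"
      using TR carrier_in_SS by auto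
    have "{U \<in> SS X\<^sub>3 K\<^sub>3. star X\<^sub>1 X\<^sub>3 K\<^sub>3 T R `` {x} \<subseteq> U} = {U \<in> SS X\<^sub>3 K\<^sub>3. (R O T) `` {x} \<subseteq> U}"
      using TR x unfolding star_def by blast
    moreover have "star X\<^sub>1 X\<^sub>3 K\<^sub>3 T R `` {x} = \<Inter>{U \<in> SS X\<^sub>3 K\<^sub>3. (R O T) `` {x} \<subseteq> U}"
      using x X3 unfolding star_def by blast
    ultimately show "star X\<^sub>1 X\<^sub>3 K\<^sub>3 T R `` {x} =
        \<Inter>{U \<in> SS X\<^sub>3 K\<^sub>3. star X\<^sub>1 X\<^sub>3 K\<^sub>3 T R `` {x} \<subseteq> U}" by simp
  qed
qed

lemma (in S_space) dual_spec_Image: "x \<in> X \<Longrightarrow> dual_spec X K `` {x} = \<Inter>{U \<in> SS X K. x \<in> U}"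
  unfolding dual_spec_def cl_K_def using carrier_in_SS by auto

lemma (in S_space) dual_spec_Image_subset:
  "\<lbrakk>x \<in> X; U \<in> SS X K\<rbrakk> \<Longrightarrow> dual_spec X K `` {x} \<subseteq> U \<longleftrightarrow> x \<in> U"
  by (auto simp: dual_spec_Image)

text \<open>Since box operators compose, this is what makes the dual specialization order neutral
  for \<open>*\<close>.\<close>

lemma (in S_space) box_dual_spec: "U \<in> SS X K \<Longrightarrow> box X (dual_spec X K) U = U"
  unfolding box_def using SS_subset dual_spec_Image_subset by blast

lemma (in S_space) meet_relation_dual_spec: "meet_relation X K X K (dual_spec X K)"
  unfolding meet_relation_def
proof (intro conjI ballI)
  show "dual_spec X K \<subseteq> X \<times> X" unfolding dual_spec_def by auto
  show "box X (dual_spec X K) U \<in> SS X K" if "U \<in> SS X K" for U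
    using that by (simp add: box_dual_spec)
  fix x assume x: "x \<in> X"
  then have "{U \<in> SS X K. dual_spec X K `` {x} \<subseteq> U} = {U \<in> SS X K. x \<in> U}"
    using dual_spec_Image_subset by blast
  then show "dual_spec X K `` {x} = \<Inter>{U \<in> SS X K. dual_spec X K `` {x} \<subseteq> U}"
    by (simp only: dual_spec_Image[OF x])
qed

text \<open>For fixed \<open>x\<close> the sets \<open>U\<close> with \<open>x \<in> h U\<close>
  include \<open>X\<^sub>2\<close> and are closed under intersection, so compactness applies: if
  their intersection \<open>T(x)\<close> lies in \<open>U\<close>, then one of them already does,
  and \<open>h\<close> is monotone because it preserves intersections. The lemma serves twice, for
  fullness of the functor and for turning a modal operator into the relation of a space.\<close>

lemma meet_relation_of_hom:
  assumes "S_space X\<^sub>1 K\<^sub>1" "S_space X\<^sub>2 K\<^sub>2"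
    and h_SS: "\<And>U. U \<in> SS X\<^sub>2 K\<^sub>2 \<Longrightarrow> h U \<in> SS X\<^sub>1 K\<^sub>1"
    and h_carrier: "h X\<^sub>2 = X\<^sub>1"
    and h_Int: "\<And>U V. \<lbrakk>U \<in> SS X\<^sub>2 K\<^sub>2; V \<in> SS X\<^sub>2 K\<^sub>2\<rbrakk> \<Longrightarrow> h (U \<inter> V) = h U \<inter> h V"
  obtains T where "meet_relation X\<^sub>1 K\<^sub>1 X\<^sub>2 K\<^sub>2 T" "\<And>U. U \<in> SS X\<^sub>2 K\<^sub>2 \<Longrightarrow> box X\<^sub>1 T U = h U"
proof -
  interpret X1: S_space X\<^sub>1 K\<^sub>1 by fact
  interpret X2: S_space X\<^sub>2 K\<^sub>2 by fact
  define T where "T = {(x, y). x \<in> X\<^sub>1 \<and> (\<forall>U\<in>SS X\<^sub>2 K\<^sub>2. x \<in> h U \<longrightarrow> y \<in> U)}"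
  have sub: "T \<subseteq> X\<^sub>1 \<times> X\<^sub>2"
    unfolding T_def using h_carrier X2.carrier_in_SS by auto
  have T_x: "T `` {x} = \<Inter>{U \<in> SS X\<^sub>2 K\<^sub>2. x \<in> h U}" if "x \<in> X\<^sub>1" for x
    unfolding T_def using that by auto
  have iff: "T `` {x} \<subseteq> U \<longleftrightarrow> x \<in> h U" if x: "x \<in> X\<^sub>1" and U: "U \<in> SS X\<^sub>2 K\<^sub>2" for x U
  proof
    assume "T `` {x} \<subseteq> U"
    then have "\<exists>V\<in>{U \<in> SS X\<^sub>2 K\<^sub>2. x \<in> h U}. V \<subseteq> U"
      using x U h_carrier X2.carrier_in_SS
      by (intro X2.filter_base_Inter_subset) (auto simp: X2.SS_Int h_Int T_x)
    then obtain V where V: "V \<in> SS X\<^sub>2 K\<^sub>2" "x \<in> h V" "V \<subseteq> U" by blast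
    then have "h V = h V \<inter> h U"
      using h_Int[OF V(1) U] by (simp add: Int_absorb2)
    then show "x \<in> h U" using V(2) by blast
  next
    assume "x \<in> h U"
    then show "T `` {x} \<subseteq> U" using U unfolding T_def by auto
  qed
  have box: "box X\<^sub>1 T U = h U" if "U \<in> SS X\<^sub>2 K\<^sub>2" for U
    unfolding box_def using that iff h_SS X1.SS_subset by blast
  have "{U \<in> SS X\<^sub>2 K\<^sub>2. T `` {x} \<subseteq> U} = {U \<in> SS X\<^sub>2 K\<^sub>2. x \<in> h U}" if "x \<in> X\<^sub>1" for x
    using iff that by blast
  then have "meet_relation X\<^sub>1 K\<^sub>1 X\<^sub>2 K\<^sub>2 T"
    unfolding meet_relation_def using sub box h_SS T_x by simp
  then show ?thesis using box by (rule that)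
qed

section \<open>Irreducible filters\<close>

locale meet_sl =
  fixes L :: "'a mod_sl"
  assumes sl: "semilattice1 L"
begin

abbreviation "A \<equiv> carr L"
abbreviation meet_op (infixl "\<sqinter>" 70) where "a \<sqinter> b \<equiv> meet L a b"
definition below (infix "\<sqsubseteq>" 50) where "a \<sqsubseteq> b \<longleftrightarrow> a \<sqinter> b = a"

lemma one_in [simp]: "one L \<in> A"
  and meet_in [simp]: "\<lbrakk>a \<in> A; b \<in> A\<rbrakk> \<Longrightarrow> a \<sqinter> b \<in> A"
  and meet_assoc: "\<lbrakk>a \<in> A; b \<in> A; c \<in> A\<rbrakk> \<Longrightarrow> a \<sqinter> b \<sqinter> c = a \<sqinter> (b \<sqinter> c)"
  and meet_commute: "\<lbrakk>a \<in> A; b \<in> A\<rbrakk> \<Longrightarrow> a \<sqinter> b = b \<sqinter> a"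
  and meet_idem [simp]: "a \<in> A \<Longrightarrow> a \<sqinter> a = a"
  and meet_one: "a \<in> A \<Longrightarrow> a \<sqinter> one L = a"
  using sl unfolding semilattice1_def by blast+

lemma below_refl: "a \<in> A \<Longrightarrow> a \<sqsubseteq> a"
  by (simp add: below_def)

lemma below_one: "a \<in> A \<Longrightarrow> a \<sqsubseteq> one L"
  by (simp add: below_def meet_one)

lemma below_trans: "\<lbrakk>a \<sqsubseteq> b; b \<sqsubseteq> c; a \<in> A; b \<in> A; c \<in> A\<rbrakk> \<Longrightarrow> a \<sqsubseteq> c"
  unfolding below_def by (metis meet_assoc)

lemma meet_below2: "\<lbrakk>a \<in> A; b \<in> A\<rbrakk> \<Longrightarrow> a \<sqinter> b \<sqsubseteq> b"
  by (simp add: below_def meet_assoc)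

lemma meet_below1: "\<lbrakk>a \<in> A; b \<in> A\<rbrakk> \<Longrightarrow> a \<sqinter> b \<sqsubseteq> a"
  using meet_below2[of b a] meet_commute[of a b] by simp

lemma below_meetI: "\<lbrakk>a \<sqsubseteq> b; a \<sqsubseteq> c; a \<in> A; b \<in> A; c \<in> A\<rbrakk> \<Longrightarrow> a \<sqsubseteq> b \<sqinter> c"
  unfolding below_def using meet_assoc[of a b c] by simp

lemma below_antisym: "\<lbrakk>a \<sqsubseteq> b; b \<sqsubseteq> a; a \<in> A; b \<in> A\<rbrakk> \<Longrightarrow> a = b"
  unfolding below_def using meet_commute[of a b] by simp

lemma meet_mono:
  assumes "a \<sqsubseteq> b" "c \<sqsubseteq> d" "a \<in> A" "b \<in> A" "c \<in> A" "d \<in> A"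
  shows "a \<sqinter> c \<sqsubseteq> b \<sqinter> d"
  using assms below_trans[OF meet_below1[of a c] assms(1)] below_trans[OF meet_below2[of a c] assms(2)]
  by (intro below_meetI) auto

definition lfilter :: "'a set \<Rightarrow> bool" where
  "lfilter F \<longleftrightarrow> F \<subseteq> A \<and> one L \<in> F \<and> (\<forall>a\<in>F. \<forall>b\<in>F. a \<sqinter> b \<in> F) \<and>
     (\<forall>a\<in>F. \<forall>b\<in>A. a \<sqsubseteq> b \<longrightarrow> b \<in> F)"

lemma lfilterD:
  assumes "lfilter F"
  shows "F \<subseteq> A" "one L \<in> F" "\<lbrakk>a \<in> F; b \<in> F\<rbrakk> \<Longrightarrow> a \<sqinter> b \<in> F" "\<lbrakk>a \<in> F; b \<in> A; a \<sqsubseteq> b\<rbrakk> \<Longrightarrow> b \<in> F"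
  using assms unfolding lfilter_def by auto

text \<open>Directedness of \<open>J\<close> for the preorder in which \<open>a\<close> lies below
  \<open>c\<close> when \<open>a \<sqinter> f \<sqsubseteq> c\<close> for some
  \<open>f \<in> F\<close>; downward closure is not demanded. It is the algebraic counterpart of
  \<open>Y_family\<close>, with \<open>F\<close> in the role of the closed subbasic sets containing
  \<open>Y\<close>.\<close>

definition relative_ideal :: "'a set \<Rightarrow> 'a set \<Rightarrow> bool" where
  "relative_ideal F J \<longleftrightarrow> J \<subseteq> A \<and>
     (\<forall>a\<in>J. \<forall>b\<in>J. \<exists>f\<in>F. \<exists>c\<in>J. a \<sqinter> f \<sqsubseteq> c \<and> b \<sqinter> f \<sqsubseteq> c)"

text \<open>A proper filter \<open>P\<close> satisfies the last condition iff \<open>P = F\<^sub>1 \<inter> F\<^sub>2\<close> implies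
  \<open>P = F\<^sub>1\<close> or \<open>P = F\<^sub>2\<close> for all filters \<open>F\<^sub>1\<close> and \<open>F\<^sub>2\<close>.\<close>

definition irreducible_filter :: "'a set \<Rightarrow> bool" where
  "irreducible_filter P \<longleftrightarrow> lfilter P \<and> P \<noteq> A \<and> relative_ideal P (A - P)"

text \<open>The set is the filter generated by \<open>F\<close> and \<open>a\<close>; the maximality
  of a filter is exploited through it.\<close>

lemma lfilter_adjoin:
  assumes F: "lfilter F" and a: "a \<in> A"
  shows "lfilter {b \<in> A. \<exists>f\<in>F. f \<sqinter> a \<sqsubseteq> b}" (is "lfilter ?Q")
  unfolding lfilter_def
proof (intro conjI ballI impI)
  have FA: "f \<in> A" if "f \<in> F" for f
    using lfilterD(1)[OF F] that by blast
  show "?Q \<subseteq> A" by blast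
  show "one L \<in> ?Q"
    using one_in lfilterD(2)[OF F] below_one[OF meet_in[OF one_in a]] by blast
  fix b assume "b \<in> ?Q"
  then obtain f where f: "b \<in> A" "f \<in> F" "f \<sqinter> a \<sqsubseteq> b" by blast
  show "c \<in> ?Q" if c: "c \<in> A" "b \<sqsubseteq> c" for c
    using below_trans[OF f(3) c(2) meet_in[OF FA[OF f(2)] a] f(1) c(1)] f(2) c(1) by blast
  fix c assume "c \<in> ?Q"
  then obtain g where g: "c \<in> A" "g \<in> F" "g \<sqinter> a \<sqsubseteq> c" by blast
  have in_A: "f \<in> A" "g \<in> A" "f \<sqinter> g \<in> A" "f \<sqinter> g \<sqinter> a \<in> A" "f \<sqinter> a \<in> A" "g \<sqinter> a \<in> A"
    using f(2) g(2) a FA by simp_all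
  have "f \<sqinter> g \<sqinter> a \<sqsubseteq> f \<sqinter> a" "f \<sqinter> g \<sqinter> a \<sqsubseteq> g \<sqinter> a"
    by (intro meet_mono meet_below1 meet_below2 below_refl in_A a)+
  then have "f \<sqinter> g \<sqinter> a \<sqsubseteq> b \<sqinter> c"
    using below_trans[OF _ f(3) in_A(4,5) f(1)] below_trans[OF _ g(3) in_A(4,6) g(1)]
    by (intro below_meetI in_A f(1) g(1))
  then show "b \<sqinter> c \<in> ?Q"
    using meet_in[OF f(1) g(1)] lfilterD(3)[OF F f(2) g(2)] by blast
qed

text \<open>A filter \<open>P\<close> maximal among those that contain \<open>F\<close> and miss
  \<open>J\<close> is irreducible: every element outside \<open>P\<close> is brought below a member
  of \<open>J\<close> by some \<open>p \<in> P\<close>, and so the directedness of \<open>J\<close>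
  modulo \<open>F\<close> passes to the complement of \<open>P\<close>. Nonemptiness of
  \<open>J\<close> keeps \<open>P\<close> proper.\<close>

theorem irreducible_filter_separation:
  assumes F: "lfilter F" and J: "relative_ideal F J" "J \<noteq> {}" and FJ: "F \<inter> J = {}"
  obtains P where "irreducible_filter P" "F \<subseteq> P" "P \<inter> J = {}"
proof -
  let ?\<A> = "{P. lfilter P \<and> F \<subseteq> P \<and> P \<inter> J = {}}"
  have "\<exists>M\<in>?\<A>. \<forall>P\<in>?\<A>. M \<subseteq> P \<longrightarrow> P = M"
  proof (rule subset_Zorn_nonempty)
    show "?\<A> \<noteq> {}" using F FJ by auto
    fix \<C> assume ne: "\<C> \<noteq> {}" and "subset.chain ?\<A> \<C>"
    then have \<C>: "\<C> \<subseteq> ?\<A>" and chain: "\<And>P Q. \<lbrakk>P \<in> \<C>; Q \<in> \<C>\<rbrakk> \<Longrightarrow> P \<subseteq> Q \<or> Q \<subseteq> P"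
      by (auto simp: subset_chain_def)
    have "lfilter (\<Union>\<C>)"
      unfolding lfilter_def
    proof (intro conjI ballI impI)
      show "\<Union>\<C> \<subseteq> A" using \<C> lfilterD(1) by blast
      show "one L \<in> \<Union>\<C>" using \<C> ne lfilterD(2) by blast
      show "b \<in> \<Union>\<C>" if "a \<in> \<Union>\<C>" "b \<in> A" "a \<sqsubseteq> b" for a b
        using that \<C> lfilterD(4) by blast
      fix a b assume "a \<in> \<Union>\<C>" "b \<in> \<Union>\<C>"
      then obtain P where "P \<in> \<C>" "a \<in> P" "b \<in> P" using chain by blast
      then show "a \<sqinter> b \<in> \<Union>\<C>" using \<C> lfilterD(3) by blast
    qed
    then show "\<Union>\<C> \<in> ?\<A>" using \<C> ne by blast
  qed
  then obtain P where P: "lfilter P" "F \<subseteq> P" "P \<inter> J = {}"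
    and max: "\<And>Q. \<lbrakk>lfilter Q; F \<subseteq> Q; Q \<inter> J = {}; P \<subseteq> Q\<rbrakk> \<Longrightarrow> Q = P" by auto
  note [simp] = lfilterD(1)[OF P(1), THEN subsetD]
  have J_A: "J \<subseteq> A" using J(1) unfolding relative_ideal_def by blast
  have meets_J: "\<exists>p\<in>P. \<exists>j\<in>J. p \<sqinter> a \<sqsubseteq> j" if a: "a \<in> A" "a \<notin> P" for a
  proof -
    let ?Q = "{b \<in> A. \<exists>f\<in>P. f \<sqinter> a \<sqsubseteq> b}"
    have "P \<subseteq> ?Q" using a meet_below1[OF _ a(1)] lfilterD(1)[OF P(1)] by blast
    moreover have "a \<in> ?Q" using a meet_below2[OF one_in a(1)] lfilterD(2)[OF P(1)] by blast
    ultimately have "?Q \<inter> J \<noteq> {}"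
      using max[OF lfilter_adjoin[OF P(1) a(1)]] P(2) a(2) by blast
    then show ?thesis by blast
  qed
  have "relative_ideal P (A - P)"
    unfolding relative_ideal_def
  proof (intro conjI ballI)
    fix a b assume a: "a \<in> A - P" and b: "b \<in> A - P"
    obtain p i where p: "p \<in> P" "i \<in> J" "p \<sqinter> a \<sqsubseteq> i" using meets_J a by blast
    obtain q j where q: "q \<in> P" "j \<in> J" "q \<sqinter> b \<sqsubseteq> j" using meets_J b by blast
    obtain f c where f: "f \<in> F" "c \<in> J" "i \<sqinter> f \<sqsubseteq> c" "j \<sqinter> f \<sqsubseteq> c"
      using J(1) p(2) q(2) unfolding relative_ideal_def by blast
    \<comment> \<open>\<open>p\<close> brings \<open>a\<close> below \<open>i\<close>,
      \<open>q\<close> brings \<open>b\<close> below \<open>j\<close>, and \<open>f\<close> brings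
      both \<open>i\<close> and \<open>j\<close> below \<open>c\<close>. The meet of the three does
      all of this at once and lies in \<open>P\<close> because
      \<open>F \<subseteq> P\<close>.\<close>
    let ?g = "p \<sqinter> q \<sqinter> f"
    have A: "a \<in> A" "b \<in> A" "i \<in> A" "j \<in> A" "c \<in> A" "p \<in> A" "q \<in> A" "f \<in> A" "?g \<in> A"
      using a b p q f J_A P(2) by auto
    have g: "?g \<in> P" using p q f P(2) lfilterD(3)[OF P(1)] by blast
    have g_below: "?g \<sqsubseteq> p" "?g \<sqsubseteq> q" "?g \<sqsubseteq> f"
      using A meet_below1[of p q] meet_below2[of p q] meet_below1[of "p \<sqinter> q" f]
        meet_below2[of "p \<sqinter> q" f] below_trans[of ?g "p \<sqinter> q" p] below_trans[of ?g "p \<sqinter> q" q]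
      by auto
    have *: "x \<sqinter> ?g \<sqsubseteq> c"
      if "x \<in> A" "k \<in> A" "r \<in> A" "r \<sqinter> x \<sqsubseteq> k" "k \<sqinter> f \<sqsubseteq> c" "?g \<sqsubseteq> r" for x k r
    proof -
      have 1: "x \<sqinter> ?g \<sqsubseteq> r \<sqinter> x"
        using that A meet_mono[of ?g r x x] below_refl[of x] meet_commute[of x ?g] by auto
      then have "x \<sqinter> ?g \<sqsubseteq> k" using that A below_trans[of "x \<sqinter> ?g" "r \<sqinter> x" k] by auto
      moreover have "x \<sqinter> ?g \<sqsubseteq> f"
        using that A g_below(3) meet_below2[of x ?g] below_trans[of "x \<sqinter> ?g" ?g f] by auto
      ultimately have "x \<sqinter> ?g \<sqsubseteq> k \<sqinter> f" using that A by (intro below_meetI) auto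
      then show ?thesis using that A below_trans[of "x \<sqinter> ?g" "k \<sqinter> f" c] by auto
    qed
    show "\<exists>f\<in>P. \<exists>c\<in>A - P. a \<sqinter> f \<sqsubseteq> c \<and> b \<sqinter> f \<sqsubseteq> c"
    proof (intro bexI conjI)
      show "a \<sqinter> ?g \<sqsubseteq> c" using p f g_below A by (intro *[of a i p]) auto
      show "b \<sqinter> ?g \<sqsubseteq> c" using q f g_below A by (intro *[of b j q]) auto
      show "c \<in> A - P" using A f P(3) by auto
    qed (rule g)
  qed auto
  moreover have "P \<noteq> A" using J(2) J_A P(3) by auto
  ultimately show ?thesis using that P unfolding irreducible_filter_def by blast
qed

text \<open>The set \<open>{a}\<close> is a relative ideal for every filter, with
  \<open>one L\<close> as the filter element.\<close>

corollary irreducible_filter_avoiding: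
  assumes F: "lfilter F" and a: "a \<in> A" "a \<notin> F"
  obtains P where "irreducible_filter P" "F \<subseteq> P" "a \<notin> P"
proof (rule irreducible_filter_separation[OF F, of "{a}"])
  show "relative_ideal F {a}"
    unfolding relative_ideal_def using a lfilterD(2)[OF F] by (auto intro!: bexI[of _ "one L"] meet_below1)
qed (use a that in auto)

end

section \<open>The S-space of irreducible filters\<close>

text \<open>Alexander's theorem concerns a whole space, here \<open>U\<close> with the traces of
  \<open>\<B>\<close> as subbase; the fact \<open>trace\<close> carries open covers from the ambient
  topology over to it.\<close>

lemma compactin_topology_generated_by:
  assumes sub: "U \<subseteq> \<Union>\<B>"
    and fin: "\<And>\<C>. \<lbrakk>\<C> \<subseteq> \<B>; U \<subseteq> \<Union>\<C>\<rbrakk> \<Longrightarrow> \<exists>\<C>'. finite \<C>' \<and> \<C>' \<subseteq> \<C> \<and> U \<subseteq> \<Union>\<C>'"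
  shows "compactin (topology_generated_by \<B>) U"
proof -
  let ?T = "topology (arbitrary union_of (finite intersection_of (\<lambda>x. x \<in> \<B>) relative_to U))"
  have compact: "compact_space ?T"
    by (rule Alexander_subbase_alt[OF sub fin]) auto
  have trace: "openin ?T (U \<inter> W)" if "generate_topology_on \<B> W" for W
    using that
  proof induction
    case (Int V W)
    have "U \<inter> (V \<inter> W) = (U \<inter> V) \<inter> (U \<inter> W)" by blast
    then show ?case using openin_Int[OF Int.IH] by simp
  next
    case (UN \<U>)
    have "U \<inter> \<Union>\<U> = \<Union>((\<inter>) U ` \<U>)" by blast
    moreover have "openin ?T (\<Union>((\<inter>) U ` \<U>))"
      using UN.IH by (intro openin_Union) (elim imageE, simp)
    ultimately show ?case by simp
  next
    case (Basis W)
    then show ?case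
      unfolding openin_subbase
      by (intro arbitrary_union_of_inc relative_to_inc finite_intersection_of_inc)
  qed simp
  show ?thesis
    unfolding compactin_def
  proof (intro conjI allI impI)
    show "U \<subseteq> topspace (topology_generated_by \<B>)" using sub by simp
    fix \<U> assume \<U>: "(\<forall>W\<in>\<U>. openin (topology_generated_by \<B>) W) \<and> U \<subseteq> \<Union>\<U>"
    have "openin ?T W" if W: "W \<in> (\<inter>) U ` \<U>" for W
    proof -
      obtain V where "V \<in> \<U>" "W = U \<inter> V" using W by blast
      then show ?thesis using \<U> by (simp add: trace openin_topology_generated_by)
    qed
    moreover have "U \<subseteq> \<Union>((\<inter>) U ` \<U>)" using \<U> by auto
    ultimately obtain \<F> where \<F>: "finite \<F>" "\<F> \<subseteq> (\<inter>) U ` \<U>" "U \<subseteq> \<Union>\<F>"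
      using compact[unfolded compact_space_alt topspace_subbase, rule_format, of "(\<inter>) U ` \<U>"]
      by auto
    then obtain \<G> where "finite \<G>" "\<G> \<subseteq> \<U>" "\<F> = (\<inter>) U ` \<G>"
      using finite_subset_image[OF \<F>(1,2)] by blast
    then show "\<exists>\<G>. finite \<G> \<and> \<G> \<subseteq> \<U> \<and> U \<subseteq> \<Union>\<G>"
      using \<F>(3) by (intro exI[of _ \<G>]) auto
  qed
qed

text \<open>Points are labels for the irreducible filters, because the point type of an S-space is
  independent of the type of the semilattice.\<close>

locale irreducible_filter_space = meet_sl L
  for L :: "'a mod_sl" +
  fixes X :: "'b set" and pt :: "'b \<Rightarrow> 'a set"
  assumes pt: "bij_betw pt X (Collect irreducible_filter)"
begin

definition \<phi> :: "'a \<Rightarrow> 'b set" where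
  "\<phi> a = {x \<in> X. a \<in> pt x}"

definition K :: "'b set set" where
  "K = (\<lambda>a. X - \<phi> a) ` A"

lemma irreducible_pt: "x \<in> X \<Longrightarrow> irreducible_filter (pt x)"
  using bij_betwE[OF pt] by simp

lemma lfilter_pt: "x \<in> X \<Longrightarrow> lfilter (pt x)"
  by (drule irreducible_pt) (simp add: irreducible_filter_def)

lemma pt_surj: "irreducible_filter P \<Longrightarrow> \<exists>x\<in>X. pt x = P"
  using bij_betw_imp_surj_on[OF pt] by (metis imageE mem_Collect_eq)

lemma \<phi>_subset: "\<phi> a \<subseteq> X"
  unfolding \<phi>_def by blast

lemma \<phi>_one: "\<phi> (one L) = X"
  unfolding \<phi>_def using lfilterD(2)[OF lfilter_pt] by auto

lemma \<phi>_meet: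
  assumes a: "a \<in> A" and b: "b \<in> A"
  shows "\<phi> (a \<sqinter> b) = \<phi> a \<inter> \<phi> b"
proof -
  have "a \<sqinter> b \<in> pt x \<longleftrightarrow> a \<in> pt x \<and> b \<in> pt x" if x: "x \<in> X" for x
    using lfilterD(3)[OF lfilter_pt[OF x]] lfilterD(4)[OF lfilter_pt[OF x]]
      meet_below1[OF a b] meet_below2[OF a b] a b by blast
  then show ?thesis unfolding \<phi>_def by blast
qed

lemma lfilter_up:
  assumes a: "a \<in> A"
  shows "lfilter {b \<in> A. a \<sqsubseteq> b}" (is "lfilter ?F")
  unfolding lfilter_def
proof (intro conjI ballI impI)
  show "?F \<subseteq> A" by blast
  show "one L \<in> ?F" using below_one[OF a] one_in by blast
  show "b \<sqinter> c \<in> ?F" if "b \<in> ?F" "c \<in> ?F" for b c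
    using that below_meetI[of a b c] a by simp
  show "c \<in> ?F" if "b \<in> ?F" "c \<in> A" "b \<sqsubseteq> c" for b c
    using that below_trans[of a b c] a by simp
qed

text \<open>The order is reflected because the filter of all elements above \<open>a\<close> extends
  to an irreducible filter avoiding \<open>b\<close> as soon as \<open>b\<close> is not in
  it.\<close>

lemma \<phi>_subset_iff:
  assumes a: "a \<in> A" and b: "b \<in> A"
  shows "\<phi> a \<subseteq> \<phi> b \<longleftrightarrow> a \<sqsubseteq> b"
proof
  show "\<phi> a \<subseteq> \<phi> b" if "a \<sqsubseteq> b"
    unfolding \<phi>_def using lfilterD(4)[OF lfilter_pt _ b that] by auto
  show "a \<sqsubseteq> b" if sub: "\<phi> a \<subseteq> \<phi> b"
  proof (rule ccontr)
    assume "\<not> a \<sqsubseteq> b"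
    then have "b \<notin> {b \<in> A. a \<sqsubseteq> b}" by blast
    then obtain P where P: "irreducible_filter P" "{b \<in> A. a \<sqsubseteq> b} \<subseteq> P" "b \<notin> P"
      using irreducible_filter_avoiding[OF lfilter_up[OF a] b] by blast
    obtain x where "x \<in> X" "pt x = P" using pt_surj[OF P(1)] by blast
    then show False using sub P(2,3) a below_refl[OF a] unfolding \<phi>_def by blast
  qed
qed

lemma inj_on_\<phi>: "inj_on \<phi> A"
proof (rule inj_onI)
  fix a b assume "a \<in> A" "b \<in> A" "\<phi> a = \<phi> b"
  then show "a = b" using \<phi>_subset_iff[of a b] \<phi>_subset_iff[of b a] by (simp add: below_antisym)
qed

lemma SS_eq: "SS X K = \<phi> ` A"
proof -
  have "SS X K = (\<lambda>U. X - U) ` K" unfolding SS_def by blast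
  also have "\<dots> = (\<lambda>a. X - (X - \<phi> a)) ` A" unfolding K_def image_image ..
  also have "\<dots> = \<phi> ` A" by (simp add: double_diff[OF \<phi>_subset])
  finally show ?thesis .
qed

lemma compactin_K:
  assumes a: "a \<in> A" and sub: "X - \<phi> a \<subseteq> \<Union>K"
  shows "compactin (topology_generated_by K) (X - \<phi> a)"
proof (rule compactin_topology_generated_by[OF sub])
  fix \<C> assume \<C>: "\<C> \<subseteq> K" "X - \<phi> a \<subseteq> \<Union>\<C>"
  \<comment> \<open>\<open>F\<close> collects the \<open>b\<close> for which
    \<open>X - \<phi> b\<close> is finitely covered by \<open>\<C>\<close>. It is a filter, so
    \<open>a \<notin> F\<close> would give a point outside \<open>\<phi> a\<close> whose filter
    contains \<open>F\<close>. The member of \<open>\<C>\<close> covering that point is some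
    \<open>X - \<phi> b\<close>; it covers itself, so \<open>b \<in> F\<close>, a
    contradiction.\<close>
  define F where "F = {b \<in> A. \<exists>\<C>'. finite \<C>' \<and> \<C>' \<subseteq> \<C> \<and> X - \<phi> b \<subseteq> \<Union>\<C>'}"
  have FI: "b \<in> F" if "b \<in> A" "finite \<C>'" "\<C>' \<subseteq> \<C>" "X - \<phi> b \<subseteq> \<Union>\<C>'" for b \<C>'
    using that unfolding F_def by (intro CollectI conjI exI[of _ \<C>'])
  have FE: thesis
    if "b \<in> F" "\<And>\<C>'. \<lbrakk>b \<in> A; finite \<C>'; \<C>' \<subseteq> \<C>; X - \<phi> b \<subseteq> \<Union>\<C>'\<rbrakk> \<Longrightarrow> thesis"
    for b thesis
    using that(1) unfolding F_def by (elim CollectE conjE exE) (rule that(2))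
  have "lfilter F"
    unfolding lfilter_def
  proof (intro conjI ballI impI)
    show "F \<subseteq> A" unfolding F_def by (rule Collect_restrict)
    show "one L \<in> F" by (rule FI[of _ "{}"]) (simp_all add: \<phi>_one)
    fix b assume "b \<in> F"
    then obtain \<C>\<^sub>1 where b: "b \<in> A" "finite \<C>\<^sub>1" "\<C>\<^sub>1 \<subseteq> \<C>" "X - \<phi> b \<subseteq> \<Union>\<C>\<^sub>1"
      by (rule FE)
    show "c \<in> F" if c: "c \<in> A" "b \<sqsubseteq> c" for c
    proof -
      have "\<phi> b \<subseteq> \<phi> c" using b(1) c by (simp add: \<phi>_subset_iff)
      then have "X - \<phi> c \<subseteq> \<Union>\<C>\<^sub>1" using b(4) by auto
      then show ?thesis by (rule FI[OF c(1) b(2,3)])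
    qed
    fix c assume "c \<in> F"
    then obtain \<C>\<^sub>2 where c: "c \<in> A" "finite \<C>\<^sub>2" "\<C>\<^sub>2 \<subseteq> \<C>" "X - \<phi> c \<subseteq> \<Union>\<C>\<^sub>2"
      by (rule FE)
    have "X - \<phi> (b \<sqinter> c) \<subseteq> \<Union>(\<C>\<^sub>1 \<union> \<C>\<^sub>2)"
      unfolding \<phi>_meet[OF b(1) c(1)] Diff_Int Union_Un_distrib using b(4) c(4) by (rule Un_mono)
    then show "b \<sqinter> c \<in> F" using b c by (intro FI[of _ "\<C>\<^sub>1 \<union> \<C>\<^sub>2"]) simp_all
  qed
  have "a \<in> F"
  proof (rule ccontr)
    assume "a \<notin> F"
    then obtain P where P: "irreducible_filter P" "F \<subseteq> P" "a \<notin> P"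
      by (rule irreducible_filter_avoiding[OF \<open>lfilter F\<close> a])
    obtain x where x: "x \<in> X" "pt x = P" using pt_surj[OF P(1)] by (elim bexE)
    then have "x \<in> X - \<phi> a" using P(3) by (simp add: \<phi>_def)
    then obtain C where C: "C \<in> \<C>" "x \<in> C" using \<C>(2) by auto
    then obtain b where b: "b \<in> A" "C = X - \<phi> b"
      using \<C>(1) unfolding K_def by auto
    then have "b \<in> F" using C(1) by (intro FI[of _ "{C}"]) simp_all
    then have "b \<in> P" using P(2) by (elim subsetD)
    then show False using b(2) C(2) x by (simp add: \<phi>_def)
  qed
  then show "\<exists>\<C>'. finite \<C>' \<and> \<C>' \<subseteq> \<C> \<and> X - \<phi> a \<subseteq> \<Union>\<C>'" unfolding F_def by simp
qed

text \<open>\<open>Y\<close> yields the filter \<open>F\<close> of all \<open>a\<close> with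
  \<open>Y \<subseteq> \<phi> a\<close>, and \<open>J\<close> yields a relative ideal
  \<open>I\<close>. The assumption \<open>meets\<close> makes \<open>F\<close> and \<open>I\<close>
  disjoint, and an irreducible filter separating them is a point of \<open>Y\<close> outside every
  member of \<open>J\<close>.\<close>

lemma S4_irreducible:
  assumes Y: "Y \<in> CK X K" and J: "Y_family X K Y J" "J \<noteq> {}"
    and meets: "\<forall>B\<in>J. Y \<inter> (X - B) \<noteq> {}"
  shows "Y \<inter> (\<Inter>B\<in>J. X - B) \<noteq> {}"
proof -
  obtain \<A> where \<A>: "Y = X \<inter> \<Inter>\<A>" "\<A> \<subseteq> \<phi> ` A"
    using Y unfolding CK_def SS_eq by (elim CollectE exE conjE)
  define F where "F = {a \<in> A. Y \<subseteq> \<phi> a}"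
  define I where "I = {a \<in> A. \<phi> a \<in> J}"
  have F_iff: "a \<in> F \<longleftrightarrow> a \<in> A \<and> Y \<subseteq> \<phi> a" and I_iff: "a \<in> I \<longleftrightarrow> a \<in> A \<and> \<phi> a \<in> J" for a
    by (simp_all add: F_def I_def)
  have J_\<phi>: "\<exists>a\<in>A. B = \<phi> a" if "B \<in> J" for B
    using J(1) that unfolding Y_family_def SS_eq by auto
  have "lfilter F"
    unfolding lfilter_def
  proof (intro conjI ballI impI)
    show "F \<subseteq> A" unfolding F_def by (rule Collect_restrict)
    show "one L \<in> F" using \<A>(1) by (simp add: F_iff \<phi>_one)
    fix b assume b: "b \<in> F"
    show "c \<in> F" if "c \<in> A" "b \<sqsubseteq> c" for c
      using b that \<phi>_subset_iff[of b c] by (auto simp: F_iff)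
    show "b \<sqinter> c \<in> F" if "c \<in> F" for c
      using b that by (simp add: F_iff \<phi>_meet)
  qed
  moreover have "relative_ideal F I"
    unfolding relative_ideal_def
  proof (intro conjI ballI)
    show "I \<subseteq> A" unfolding I_def by (rule Collect_restrict)
    fix a b assume "a \<in> I" "b \<in> I"
    then have ab: "a \<in> A" "b \<in> A" "\<phi> a \<in> J" "\<phi> b \<in> J" by (simp_all add: I_iff)
    obtain H C where H: "H \<in> SS X K" "Y \<subseteq> H" and C: "C \<in> J" "\<phi> a \<inter> H \<subseteq> C" "\<phi> b \<inter> H \<subseteq> C"
      using J(1)[unfolded Y_family_def, THEN conjunct2, rule_format, OF ab(3,4)]
      by (elim bexE conjE)
    obtain f where f: "f \<in> A" "H = \<phi> f" using H(1) unfolding SS_eq by (elim imageE)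
    obtain c where c: "c \<in> A" "C = \<phi> c" using J_\<phi>[OF C(1)] by (elim bexE)
    have "a \<sqinter> f \<sqsubseteq> c" "b \<sqinter> f \<sqsubseteq> c"
      using C(2,3) ab f c by (simp_all add: \<phi>_subset_iff[symmetric] \<phi>_meet)
    moreover have "f \<in> F" "c \<in> I" using f c H C by (simp_all add: F_iff I_iff)
    ultimately show "\<exists>f\<in>F. \<exists>c\<in>I. a \<sqinter> f \<sqsubseteq> c \<and> b \<sqinter> f \<sqsubseteq> c" by (intro bexI conjI)
  qed
  moreover obtain B where "B \<in> J" using J(2) by auto
  then have "I \<noteq> {}" using J_\<phi>[of B] by (auto simp: I_iff)
  moreover have "F \<inter> I = {}"
  proof (rule equals0I)
    fix a assume "a \<in> F \<inter> I"
    then have "Y \<inter> (X - \<phi> a) \<noteq> {}" "Y \<subseteq> \<phi> a" using meets by (simp_all add: F_iff I_iff)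
    then show False by auto
  qed
  ultimately obtain P where P: "irreducible_filter P" "F \<subseteq> P" "P \<inter> I = {}"
    by (rule irreducible_filter_separation)
  obtain x where x: "x \<in> X" "pt x = P" using pt_surj[OF P(1)] by (elim bexE)
  \<comment> \<open>Here \<open>Y \<in> CK X K\<close> matters: \<open>Y\<close> is cut out by sets
    \<open>\<phi> a\<close>, each containing \<open>Y\<close>, so that
    \<open>a \<in> F \<subseteq> P\<close>.\<close>
  have "x \<in> Y"
    unfolding \<A>(1)
  proof (intro IntI InterI x(1))
    fix B assume B: "B \<in> \<A>"
    then obtain a where a: "a \<in> A" "B = \<phi> a" using \<A>(2) by auto
    have "Y \<subseteq> B" unfolding \<A>(1) using B by auto
    then have "a \<in> P" using P(2) a by (auto simp: F_iff)
    then show "x \<in> B" using x a(2) by (simp add: \<phi>_def)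
  qed
  moreover have "x \<in> X - B" if B: "B \<in> J" for B
  proof -
    obtain a where a: "a \<in> A" "B = \<phi> a" using J_\<phi>[OF B] by (elim bexE)
    then have "a \<notin> P" using P(3) B by (auto simp: I_iff)
    then show ?thesis using x a(2) by (simp add: \<phi>_def)
  qed
  ultimately show ?thesis by auto
qed

text \<open>Properness of the filters gives the cover, injectivity of \<open>pt\<close> gives the
  separation axiom, and \<open>\<phi>_meet\<close> gives closure under unions.\<close>

sublocale S_space X K
proof
  show "K \<subseteq> Pow X" unfolding K_def by blast
  show cover: "X = \<Union>K"
  proof (intro antisym subsetI)
    fix x assume x: "x \<in> X"
    have "pt x \<subset> A"
      using irreducible_pt[OF x] lfilterD(1)[OF lfilter_pt[OF x]]
      by (simp add: irreducible_filter_def psubset_eq)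
    then obtain a where "a \<in> A" "a \<notin> pt x" by auto
    then show "x \<in> \<Union>K" using x by (auto simp: K_def \<phi>_def)
  qed (auto simp: K_def)
  show "t0_space (topology_generated_by K)"
    unfolding t0_space_def
  proof (intro ballI impI)
    fix x y assume "x \<in> topspace (topology_generated_by K)" "y \<in> topspace (topology_generated_by K)"
    then have xy: "x \<in> X" "y \<in> X" using cover by simp_all
    assume "x \<noteq> y"
    then have "pt x \<noteq> pt y" using bij_betw_imp_inj_on[OF pt] xy by (auto dest: inj_onD)
    moreover have "pt x \<subseteq> A" "pt y \<subseteq> A" using lfilterD(1)[OF lfilter_pt] xy by simp_all
    ultimately obtain a where a: "a \<in> A" "(a \<in> pt x) \<noteq> (a \<in> pt y)" by auto
    then have "openin (topology_generated_by K) (X - \<phi> a)"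
      unfolding K_def by (intro topology_generated_by_Basis imageI)
    moreover have "x \<notin> X - \<phi> a \<longleftrightarrow> y \<in> X - \<phi> a"
      using a(2) xy by (simp add: \<phi>_def)
    ultimately show "\<exists>U. openin (topology_generated_by K) U \<and> (x \<notin> U \<longleftrightarrow> y \<in> U)"
      by (intro exI[of _ "X - \<phi> a"] conjI)
  qed
  show "compactin (topology_generated_by K) U" if U: "U \<in> K" for U
  proof -
    obtain a where a: "a \<in> A" "U = X - \<phi> a" using U unfolding K_def by (elim imageE)
    have "X - \<phi> a \<subseteq> \<Union>K" using U a(2) by auto
    then show ?thesis unfolding a(2) by (rule compactin_K[OF a(1)])
  qed
  show "U \<union> V \<in> K" if UV: "U \<in> K" "V \<in> K" for U V
  proof -
    obtain a b where ab: "a \<in> A" "U = X - \<phi> a" "b \<in> A" "V = X - \<phi> b"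
      using UV unfolding K_def by (elim imageE)
    then have "U \<union> V = X - \<phi> (a \<sqinter> b)" by (auto simp: \<phi>_meet)
    then show ?thesis unfolding K_def using meet_in[OF ab(1,3)] by simp
  qed
  show "{} \<in> K"
    unfolding K_def by (rule image_eqI[OF _ one_in]) (simp add: \<phi>_one)
  show "\<exists>W\<in>K. \<exists>D\<in>K. x \<notin> W \<and> x \<in> D \<and> D \<subseteq> (U \<inter> V) \<union> W"
    if UV: "U \<in> K" "V \<in> K" and x: "x \<in> U \<inter> V" for U V x
  proof -
    obtain a b where ab: "a \<in> A" "U = X - \<phi> a" "b \<in> A" "V = X - \<phi> b"
      using UV unfolding K_def by (elim imageE)
    have xX: "x \<in> X" and "a \<in> A - pt x" "b \<in> A - pt x"
      using x ab by (auto simp: \<phi>_def)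
    moreover have "relative_ideal (pt x) (A - pt x)"
      using irreducible_pt[OF xX] by (simp add: irreducible_filter_def)
    \<comment> \<open>\<open>f\<close> will give \<open>W\<close> and \<open>c\<close> will give
      \<open>D\<close>: after taking complements the two inequalities put
      \<open>X - \<phi> c\<close> inside
      \<open>(U \<inter> V) \<union> (X - \<phi> f)\<close>.\<close>
    ultimately obtain f c where fc: "f \<in> pt x" "c \<in> A - pt x" "a \<sqinter> f \<sqsubseteq> c" "b \<sqinter> f \<sqsubseteq> c"
      unfolding relative_ideal_def by (metis (no_types))
    have f: "f \<in> A" using fc(1) lfilterD(1)[OF lfilter_pt[OF xX]] by auto
    have "\<phi> a \<inter> \<phi> f \<subseteq> \<phi> c" "\<phi> b \<inter> \<phi> f \<subseteq> \<phi> c"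
      using fc ab f by (simp_all add: \<phi>_subset_iff \<phi>_meet[symmetric])
    then have "X - \<phi> c \<subseteq> (U \<inter> V) \<union> (X - \<phi> f)" unfolding ab(2,4) by auto
    moreover have "x \<notin> X - \<phi> f" "x \<in> X - \<phi> c" using fc xX by (simp_all add: \<phi>_def)
    moreover have "X - \<phi> f \<in> K" "X - \<phi> c \<in> K" using f fc(2) by (simp_all add: K_def)
    ultimately show ?thesis by (intro bexI[of _ "X - \<phi> f"] bexI[of _ "X - \<phi> c"] conjI)
  qed
qed (rule S4_irreducible)

end

section \<open>The categories of modal semilattices and of MoS-spaces\<close>

lemma modal_semilatticeD:
  assumes "modal_semilattice L"
  shows "one L \<in> carr L"
    "\<lbrakk>a \<in> carr L; b \<in> carr L\<rbrakk> \<Longrightarrow> meet L a b \<in> carr L"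
    "a \<in> carr L \<Longrightarrow> dia L a \<in> carr L"
    "dia L (one L) = one L"
    "\<lbrakk>a \<in> carr L; b \<in> carr L\<rbrakk> \<Longrightarrow> dia L (meet L a b) = meet L (dia L a) (dia L b)"
  using assms unfolding modal_semilattice_def semilattice1_def by (auto simp: Pi_iff)

lemma modal_homD:
  assumes "h \<in> modal_hom L M"
  shows "h \<in> carr L \<rightarrow>\<^sub>E carr M"
    "a \<in> carr L \<Longrightarrow> h a \<in> carr M"
    "h (one L) = one M"
    "\<lbrakk>a \<in> carr L; b \<in> carr L\<rbrakk> \<Longrightarrow> h (meet L a b) = meet M (h a) (h b)"
    "a \<in> carr L \<Longrightarrow> h (dia L a) = dia M (h a)"
  using assms unfolding modal_hom_def by auto

lemma modal_hom_compose:
  assumes L: "modal_semilattice L" and f: "f \<in> modal_hom L M" and g: "g \<in> modal_hom M N"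
  shows "compose (carr L) g f \<in> modal_hom L N"
  unfolding modal_hom_def
  using modal_semilatticeD[OF L] modal_homD[OF f] modal_homD[OF g]
  by (auto simp: compose_def)

lemma modal_hom_id: "modal_semilattice L \<Longrightarrow> (\<lambda>a\<in>carr L. a) \<in> modal_hom L L"
  unfolding modal_hom_def using modal_semilatticeD[of L] by auto

lemma category_MoSL: "category (MoSL \<S>)"
proof
  fix A B D E :: "'a mod_sl" and f g h
  assume f: "f \<in> Hom (MoSL \<S>) A B"
  then have "f \<in> carr A \<rightarrow>\<^sub>E carr B" by (simp add: MoSL_def modal_hom_def)
  then have f': "f \<in> carr A \<rightarrow> carr B" "f \<in> extensional (carr A)" by (simp_all add: PiE_def)
  show "Comp (MoSL \<S>) A A B f (Ident (MoSL \<S>) A) = f"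
    using compose_Id[OF f'] by (simp add: MoSL_def)
  show "Comp (MoSL \<S>) A B B (Ident (MoSL \<S>) B) f = f"
    using Id_compose[OF f'] by (simp add: MoSL_def)
  show "Comp (MoSL \<S>) A D E h (Comp (MoSL \<S>) A B D g f) =
      Comp (MoSL \<S>) A B E (Comp (MoSL \<S>) B D E h g) f"
    using compose_assoc[OF f'(1)] by (simp add: MoSL_def)
qed (auto simp: MoSL_def intro: modal_hom_id modal_hom_compose)

lemma modal_hom_inverse:
  assumes L: "modal_semilattice L" and f: "f \<in> modal_hom L M" and bij: "bij_betw f (carr L) (carr M)"
  shows "(\<lambda>b\<in>carr M. inv_into (carr L) f b) \<in> modal_hom M L"
proof -
  define g where "g = (\<lambda>b\<in>carr M. inv_into (carr L) f b)"
  have gM: "g b \<in> carr L" and fg: "f (g b) = b" if "b \<in> carr M" for b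
    using that bij by (auto simp: g_def bij_betw_def intro: inv_into_into f_inv_into_f)
  have gf: "g (f a) = a" if "a \<in> carr L" for a
    using that bij modal_homD(2)[OF f] by (simp add: g_def bij_betw_def)
  show ?thesis
    unfolding modal_hom_def g_def[symmetric]
  proof (intro CollectI conjI ballI)
    show "g \<in> carr M \<rightarrow>\<^sub>E carr L" using gM by (auto simp: g_def)
    show "g (one M) = one L"
      using gf[OF modal_semilatticeD(1)[OF L]] modal_homD(3)[OF f] by simp
    fix b assume b: "b \<in> carr M"
    show "g (dia M b) = dia L (g b)"
      using gf[OF modal_semilatticeD(3)[OF L gM[OF b]]] modal_homD(5)[OF f gM[OF b]] fg[OF b] by simp
    fix c assume c: "c \<in> carr M"
    show "g (meet M b c) = meet L (g b) (g c)"
      using gf[OF modal_semilatticeD(2)[OF L gM[OF b] gM[OF c]]]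
        modal_homD(4)[OF f gM[OF b] gM[OF c]] fg[OF b] fg[OF c] by simp
  qed
qed

text \<open>The inverse is the isomorphism recorded, because essential surjectivity is needed in the
  opposite category: there an arrow from \<open>A\<close> to a semilattice of closed sets is a
  homomorphism back to \<open>A\<close>.\<close>

lemma cat_iso_MoSL:
  assumes L: "modal_semilattice L"
    and f: "f \<in> modal_hom L M" and bij: "bij_betw f (carr L) (carr M)"
  shows "cat_iso (MoSL \<S>) M L (\<lambda>b\<in>carr M. inv_into (carr L) f b)"
  unfolding cat_iso_def
proof (intro conjI bexI[of _ f])
  have surj: "f ` carr L = carr M" and inj: "inj_on f (carr L)" using bij by (auto simp: bij_betw_def)
  show "Comp (MoSL \<S>) M L M f (\<lambda>b\<in>carr M. inv_into (carr L) f b) = Ident (MoSL \<S>) M"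
    using compose_id_inv_into[OF surj] by (simp add: MoSL_def)
  show "Comp (MoSL \<S>) L M L (\<lambda>b\<in>carr M. inv_into (carr L) f b) f = Ident (MoSL \<S>) L"
    using compose_inv_into_id[OF bij] by (simp add: MoSL_def)
qed (use f modal_hom_inverse[OF L f bij] in \<open>simp_all add: MoSL_def\<close>)

section \<open>MoS-spaces and compatible meet-relations\<close>

abbreviation closed_sets :: "'b mos_space \<Rightarrow> 'b set set" where
  "closed_sets S \<equiv> SS (pts S) (subbase S)"

abbreviation meet_rel :: "'b mos_space \<Rightarrow> 'c mos_space \<Rightarrow> ('b \<times> 'c) set \<Rightarrow> bool" where
  "meet_rel S S' \<equiv> meet_relation (pts S) (subbase S) (pts S') (subbase S')"

lemma MoS_spaceD:
  assumes "MoS_space S"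
  shows "S_space (pts S) (subbase S)" "meet_rel S S (rel S)"
  using assms unfolding MoS_space_def by auto

text \<open>Both composites in the definition of compatibility are meet-relations, so they coincide
  iff their box operators do, and \<open>box_star\<close> splits these. What results is the
  condition that the box operator of \<open>M\<close> be a modal homomorphism.\<close>

lemma compatible_meet_rel_iff:
  assumes S: "MoS_space S" and S': "MoS_space S'"
  shows "M \<in> compatible_meet_rel S S' \<longleftrightarrow> meet_rel S S' M \<and>
    (\<forall>U\<in>closed_sets S'. box (pts S) (rel S) (box (pts S) M U) = box (pts S) M (box (pts S') (rel S') U))"
proof (cases "meet_rel S S' M")
  case M: True
  note R = MoS_spaceD(2)[OF S] and R' = MoS_spaceD(2)[OF S']
  let ?MR = "star (pts S) (pts S') (subbase S') M (rel S)"
  let ?RM = "star (pts S) (pts S') (subbase S') (rel S') M"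
  have mr: "meet_rel S S' ?MR" "meet_rel S S' ?RM"
    by (rule meet_relation_star[OF MoS_spaceD(1)[OF S'] M R]
        meet_relation_star[OF MoS_spaceD(1)[OF S'] R' M])+
  have "?MR = ?RM \<longleftrightarrow> (\<forall>U\<in>closed_sets S'. box (pts S) ?MR U = box (pts S) ?RM U)"
    using meet_relation_eqI[OF mr] by auto
  also have "\<dots> \<longleftrightarrow> (\<forall>U\<in>closed_sets S'.
      box (pts S) (rel S) (box (pts S) M U) = box (pts S) M (box (pts S') (rel S') U))"
    by (simp add: box_star[OF M R] box_star[OF R' M])
  finally show ?thesis
    using M by (simp add: compatible_meet_rel_def)
qed (simp add: compatible_meet_rel_def)

lemma compatible_meet_relD:
  assumes "MoS_space S" "MoS_space S'" "M \<in> compatible_meet_rel S S'"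
  shows "meet_rel S S' M"
    "U \<in> closed_sets S' \<Longrightarrow>
      box (pts S) (rel S) (box (pts S) M U) = box (pts S) M (box (pts S') (rel S') U)"
  using assms by (simp_all add: compatible_meet_rel_iff)

lemma compatible_dual_spec:
  assumes S: "MoS_space S"
  shows "dual_spec (pts S) (subbase S) \<in> compatible_meet_rel S S"
proof -
  interpret S_space "pts S" "subbase S" by (rule MoS_spaceD(1)[OF S])
  show ?thesis
    using box_in_SS[OF MoS_spaceD(2)[OF S]]
    by (simp add: compatible_meet_rel_iff[OF S S] meet_relation_dual_spec box_dual_spec)
qed

lemma compatible_star:
  assumes S: "MoS_space S\<^sub>1" "MoS_space S\<^sub>2" "MoS_space S\<^sub>3"
    and M: "M \<in> compatible_meet_rel S\<^sub>1 S\<^sub>2" and N: "N \<in> compatible_meet_rel S\<^sub>2 S\<^sub>3"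
  shows "star (pts S\<^sub>1) (pts S\<^sub>3) (subbase S\<^sub>3) N M \<in> compatible_meet_rel S\<^sub>1 S\<^sub>3"
proof -
  note M' = compatible_meet_relD[OF S(1,2) M] and N' = compatible_meet_relD[OF S(2,3) N]
  show ?thesis
    unfolding compatible_meet_rel_iff[OF S(1,3)]
  proof (intro conjI ballI)
    show "meet_rel S\<^sub>1 S\<^sub>3 (star (pts S\<^sub>1) (pts S\<^sub>3) (subbase S\<^sub>3) N M)"
      by (rule meet_relation_star[OF MoS_spaceD(1)[OF S(3)] N'(1) M'(1)])
    fix U assume U: "U \<in> closed_sets S\<^sub>3"
    show "box (pts S\<^sub>1) (rel S\<^sub>1) (box (pts S\<^sub>1) (star (pts S\<^sub>1) (pts S\<^sub>3) (subbase S\<^sub>3) N M) U) =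
        box (pts S\<^sub>1) (star (pts S\<^sub>1) (pts S\<^sub>3) (subbase S\<^sub>3) N M) (box (pts S\<^sub>3) (rel S\<^sub>3) U)"
      using U box_in_SS[OF MoS_spaceD(2)[OF S(3)] U] box_in_SS[OF N'(1) U]
      by (simp add: box_star[OF N'(1) M'(1)] M'(2) N'(2))
  qed
qed

lemma category_MoSsp: "category (MoSsp \<S> :: ('b mos_space, ('b \<times> 'b) set) cat)"
proof
  fix A B D E :: "'b mos_space" and f g h
  assume A: "A \<in> Obj (MoSsp \<S>)" and B: "B \<in> Obj (MoSsp \<S>)" and f: "f \<in> Hom (MoSsp \<S>) A B"
  have AB: "MoS_space A" "MoS_space B" using A B by (simp_all add: MoSsp_def)
  have f': "meet_rel A B f"
    using f compatible_meet_relD(1)[OF AB] by (simp add: MoSsp_def)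
  interpret A: S_space "pts A" "subbase A" by (rule MoS_spaceD(1)[OF AB(1)])
  interpret B: S_space "pts B" "subbase B" by (rule MoS_spaceD(1)[OF AB(2)])
  show "Comp (MoSsp \<S>) A A B f (Ident (MoSsp \<S>) A) = f"
  proof (simp add: MoSsp_def, rule meet_relation_eqI[OF meet_relation_star f'])
    show "box (pts A) (star (pts A) (pts B) (subbase B) f (dual_spec (pts A) (subbase A))) U =
        box (pts A) f U" if "U \<in> closed_sets B" for U
      using that box_in_SS[OF f' that]
      by (simp add: box_star[OF f' A.meet_relation_dual_spec] A.box_dual_spec)
  qed (rule MoS_spaceD(1)[OF AB(2)] f' A.meet_relation_dual_spec)+
  show "Comp (MoSsp \<S>) A B B (Ident (MoSsp \<S>) B) f = f"
  proof (simp add: MoSsp_def, rule meet_relation_eqI[OF meet_relation_star f'])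
    show "box (pts A) (star (pts A) (pts B) (subbase B) (dual_spec (pts B) (subbase B)) f) U =
        box (pts A) f U" if "U \<in> closed_sets B" for U
      using that by (simp add: box_star[OF B.meet_relation_dual_spec f'] B.box_dual_spec)
  qed (rule MoS_spaceD(1)[OF AB(2)] f' B.meet_relation_dual_spec)+
  assume D: "D \<in> Obj (MoSsp \<S>)" and E: "E \<in> Obj (MoSsp \<S>)"
    and g: "g \<in> Hom (MoSsp \<S>) B D" and h: "h \<in> Hom (MoSsp \<S>) D E"
  have DE: "MoS_space D" "MoS_space E" using D E by (simp_all add: MoSsp_def)
  have g': "meet_rel B D g" and h': "meet_rel D E h"
    using g h compatible_meet_relD(1)[OF AB(2) DE(1)] compatible_meet_relD(1)[OF DE]
    by (simp_all add: MoSsp_def)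
  note sE = MoS_spaceD(1)[OF DE(2)] and sD = MoS_spaceD(1)[OF DE(1)]
  \<comment> \<open>\<open>box_star\<close> applies to the outer composites only once the inner ones
    are known to be meet-relations.\<close>
  note gf = meet_relation_star[OF sD g' f'] and hg = meet_relation_star[OF sE h' g']
  show "Comp (MoSsp \<S>) A D E h (Comp (MoSsp \<S>) A B D g f) =
      Comp (MoSsp \<S>) A B E (Comp (MoSsp \<S>) B D E h g) f"
    unfolding MoSsp_def cat.simps
  proof (rule meet_relation_eqI[OF meet_relation_star[OF sE h' gf] meet_relation_star[OF sE hg f']])
    fix U assume U: "U \<in> closed_sets E"
    show "box (pts A) (star (pts A) (pts E) (subbase E) h (star (pts A) (pts D) (subbase D) g f)) U =
        box (pts A) (star (pts A) (pts E) (subbase E) (star (pts B) (pts E) (subbase E) h g) f) U"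
      using U box_in_SS[OF h' U]
      by (simp add: box_star[OF h' gf] box_star[OF hg f'] box_star[OF g' f'] box_star[OF h' g'])
  qed
qed (auto simp: MoSsp_def intro: compatible_dual_spec compatible_star)

section \<open>The functor of closed subbasic sets\<close>

text \<open>\<open>SS X K\<close> is a modal semilattice over the type \<open>'b set\<close>; the injection \<open>enc\<close> moves it to the
  type \<open>'a\<close> in which the objects of \<open>MoSL \<S>\<close> live.\<close>

definition enc :: "'a set set \<Rightarrow> 'b mos_space \<Rightarrow> 'b set \<Rightarrow> 'a" where
  "enc \<S> S = (SOME f. inj_on f (closed_sets S) \<and> f ` closed_sets S \<in> \<S>)"

definition dec :: "'a set set \<Rightarrow> 'b mos_space \<Rightarrow> 'a \<Rightarrow> 'b set" where
  "dec \<S> S = inv_into (closed_sets S) (enc \<S> S)"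

definition closed_sl :: "'a set set \<Rightarrow> 'b mos_space \<Rightarrow> 'a mod_sl" where
  "closed_sl \<S> S = \<lparr>carr = enc \<S> S ` closed_sets S,
     meet = (\<lambda>a b. enc \<S> S (dec \<S> S a \<inter> dec \<S> S b)),
     one = enc \<S> S (pts S),
     dia = (\<lambda>a. enc \<S> S (box (pts S) (rel S) (dec \<S> S a)))\<rparr>"

text \<open>The direction is reversed: a relation from \<open>S\<close> to \<open>S'\<close> gives a
  map from \<open>closed_sl \<S> S'\<close> to \<open>closed_sl \<S> S\<close>. The restriction
  makes it extensional, as \<open>modal_hom\<close> requires.\<close>

definition box_hom ::
  "'a set set \<Rightarrow> 'b mos_space \<Rightarrow> 'b mos_space \<Rightarrow> ('b \<times> 'b) set \<Rightarrow> 'a \<Rightarrow> 'a" where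
  "box_hom \<S> S S' M = (\<lambda>a\<in>carr (closed_sl \<S> S'). enc \<S> S (box (pts S) M (dec \<S> S' a)))"

lemma closed_sl_sel [simp]:
  "carr (closed_sl \<S> S) = enc \<S> S ` closed_sets S"
  "meet (closed_sl \<S> S) a b = enc \<S> S (dec \<S> S a \<inter> dec \<S> S b)"
  "one (closed_sl \<S> S) = enc \<S> S (pts S)"
  "dia (closed_sl \<S> S) a = enc \<S> S (box (pts S) (rel S) (dec \<S> S a))"
  by (simp_all add: closed_sl_def)

locale small_MoS_space = S_space "pts S" "subbase S"
  for \<S> :: "'a set set" and S :: "'b mos_space" +
  assumes MoS: "MoS_space S" and small: "\<exists>A\<in>\<S>. closed_sets S \<approx> A"
begin

lemma enc_inj: "inj_on (enc \<S> S) (closed_sets S)"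
  and enc_image: "enc \<S> S ` closed_sets S \<in> \<S>"
proof -
  obtain A f where "A \<in> \<S>" "bij_betw f (closed_sets S) A"
    using small unfolding eqpoll_def by blast
  then have "inj_on f (closed_sets S) \<and> f ` closed_sets S \<in> \<S>"
    by (simp add: bij_betw_def)
  then have "inj_on (enc \<S> S) (closed_sets S) \<and> enc \<S> S ` closed_sets S \<in> \<S>"
    unfolding enc_def by (rule someI[of "\<lambda>f. inj_on f (closed_sets S) \<and> f ` closed_sets S \<in> \<S>"])
  then show "inj_on (enc \<S> S) (closed_sets S)" "enc \<S> S ` closed_sets S \<in> \<S>" by simp_all
qed

lemma dec_enc [simp]: "U \<in> closed_sets S \<Longrightarrow> dec \<S> S (enc \<S> S U) = U"
  unfolding dec_def by (rule inv_into_f_f[OF enc_inj])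

lemma enc_eq_iff [simp]:
  "\<lbrakk>U \<in> closed_sets S; V \<in> closed_sets S\<rbrakk> \<Longrightarrow> enc \<S> S U = enc \<S> S V \<longleftrightarrow> U = V"
  by (rule inj_on_eq_iff[OF enc_inj])

lemmas box_rel_in = box_in_SS[OF MoS_spaceD(2)[OF MoS]]

lemma modal_semilattice_closed_sl: "modal_semilattice (closed_sl \<S> S)"
  unfolding modal_semilattice_def semilattice1_def
  using carrier_in_SS
  by (auto simp: SS_Int box_rel_in box_carrier[OF MoS_spaceD(2)[OF MoS]] box_Int Int_ac
      Int_absorb2[OF SS_subset])

end

lemma small_MoS_spaceI: "S \<in> Obj (MoSsp \<S>) \<Longrightarrow> small_MoS_space \<S> S"
  unfolding small_MoS_space_def small_MoS_space_axioms_def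
  by (simp add: MoSsp_def MoS_spaceD(1))

lemma box_hom_enc:
  "\<lbrakk>small_MoS_space \<S> S'; U \<in> closed_sets S'\<rbrakk> \<Longrightarrow>
    box_hom \<S> S S' M (enc \<S> S' U) = enc \<S> S (box (pts S) M U)"
  by (simp add: box_hom_def small_MoS_space.dec_enc)

lemma box_hom_modal_hom:
  assumes S: "small_MoS_space \<S> S" and S': "small_MoS_space \<S> S'"
    and M: "M \<in> compatible_meet_rel S S'"
  shows "box_hom \<S> S S' M \<in> modal_hom (closed_sl \<S> S') (closed_sl \<S> S)"
proof -
  interpret S: small_MoS_space \<S> S by fact
  interpret S': small_MoS_space \<S> S' by fact
  note M' = compatible_meet_relD[OF S.MoS S'.MoS M]
  note [simp] = box_hom_enc[OF S'] box_in_SS[OF M'(1)] S'.SS_Int S'.box_rel_in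
  show ?thesis
    unfolding modal_hom_def
  proof (intro CollectI conjI PiE_I ballI)
    show "box_hom \<S> S S' M (one (closed_sl \<S> S')) = one (closed_sl \<S> S)"
      by (simp add: S'.carrier_in_SS box_carrier[OF M'(1)])
    fix a assume "a \<in> carr (closed_sl \<S> S')"
    then obtain U where U: "U \<in> closed_sets S'" "a = enc \<S> S' U" by auto
    then show "box_hom \<S> S S' M a \<in> carr (closed_sl \<S> S)" by simp
    show "box_hom \<S> S S' M (dia (closed_sl \<S> S') a) = dia (closed_sl \<S> S) (box_hom \<S> S S' M a)"
      using U by (simp add: M'(2))
    fix b assume "b \<in> carr (closed_sl \<S> S')"
    then obtain V where V: "V \<in> closed_sets S'" "b = enc \<S> S' V" by auto
    show "box_hom \<S> S S' M (meet (closed_sl \<S> S') a b) =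
        meet (closed_sl \<S> S) (box_hom \<S> S S' M a) (box_hom \<S> S S' M b)"
      using U V by (simp add: box_Int)
  qed (simp add: box_hom_def)
qed

text \<open>Injectivity is \<open>meet_relation_eqI\<close>. For surjectivity a homomorphism
  \<open>h\<close> is decoded to an operator \<open>k\<close> on closed subbasic sets, for which
  \<open>meet_relation_of_hom\<close> provides a relation.\<close>

lemma bij_betw_box_hom:
  assumes S: "small_MoS_space \<S> S" and S': "small_MoS_space \<S> S'"
  shows "bij_betw (box_hom \<S> S S') (compatible_meet_rel S S')
    (modal_hom (closed_sl \<S> S') (closed_sl \<S> S))"
proof (intro bij_betw_imageI inj_onI subset_antisym[OF image_subsetI subsetI])
  interpret S: small_MoS_space \<S> S by fact
  interpret S': small_MoS_space \<S> S' by fact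
  show "M = N"
    if M: "M \<in> compatible_meet_rel S S'" and N: "N \<in> compatible_meet_rel S S'"
      and eq: "box_hom \<S> S S' M = box_hom \<S> S S' N" for M N
  proof -
    note M' = compatible_meet_relD(1)[OF S.MoS S'.MoS M]
      and N' = compatible_meet_relD(1)[OF S.MoS S'.MoS N]
    have "box (pts S) M U = box (pts S) N U" if U: "U \<in> closed_sets S'" for U
      using fun_cong[OF eq, of "enc \<S> S' U"] U box_in_SS[OF M' U] box_in_SS[OF N' U]
      by (simp add: box_hom_enc[OF S'])
    then show ?thesis by (rule meet_relation_eqI[OF M' N'])
  qed
  show "box_hom \<S> S S' M \<in> modal_hom (closed_sl \<S> S') (closed_sl \<S> S)"
    if "M \<in> compatible_meet_rel S S'" for M
    by (rule box_hom_modal_hom[OF S S' that])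
  fix h assume h: "h \<in> modal_hom (closed_sl \<S> S') (closed_sl \<S> S)"
  define k where "k U = dec \<S> S (h (enc \<S> S' U))" for U
  have k_in: "k U \<in> closed_sets S" and enc_k: "enc \<S> S (k U) = h (enc \<S> S' U)"
    if U: "U \<in> closed_sets S'" for U
  proof -
    obtain V where "V \<in> closed_sets S" "h (enc \<S> S' U) = enc \<S> S V"
      using modal_homD(2)[OF h, of "enc \<S> S' U"] U by auto
    then show "k U \<in> closed_sets S" "enc \<S> S (k U) = h (enc \<S> S' U)"
      by (simp_all add: k_def)
  qed
  have k_one: "k (pts S') = pts S"
    using modal_homD(3)[OF h] by (simp add: k_def S.carrier_in_SS)
  have k_Int: "k (U \<inter> V) = k U \<inter> k V"
    if UV: "U \<in> closed_sets S'" "V \<in> closed_sets S'" for U V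
    using modal_homD(4)[OF h, of "enc \<S> S' U" "enc \<S> S' V"] UV k_in[OF UV(1)] k_in[OF UV(2)]
    by (simp add: k_def S.SS_Int)
  obtain M where M: "meet_rel S S' M" and box: "\<And>U. U \<in> closed_sets S' \<Longrightarrow> box (pts S) M U = k U"
    using meet_relation_of_hom[of "pts S" "subbase S" "pts S'" "subbase S'" k,
        OF S.S_space_axioms S'.S_space_axioms k_in k_one k_Int] by metis
  \<comment> \<open>Preservation of \<open>dia\<close> by \<open>h\<close>, decoded; this is what
    compatibility of \<open>M\<close> amounts to.\<close>
  have "box (pts S) (rel S) (k U) = k (box (pts S') (rel S') U)" if U: "U \<in> closed_sets S'" for U
    using modal_homD(5)[OF h, of "enc \<S> S' U"] U S.box_rel_in[OF k_in[OF U]]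
    by (simp add: k_def)
  then have "M \<in> compatible_meet_rel S S'"
    using M by (simp add: compatible_meet_rel_iff[OF S.MoS S'.MoS] box S'.box_rel_in)
  moreover have "h = box_hom \<S> S S' M"
  proof (rule extensionalityI[of _ "carr (closed_sl \<S> S')"])
    show "h \<in> extensional (carr (closed_sl \<S> S'))"
      using modal_homD(1)[OF h] by (simp only: PiE_iff)
    show "box_hom \<S> S S' M \<in> extensional (carr (closed_sl \<S> S'))"
      by (simp add: box_hom_def)
    fix a assume "a \<in> carr (closed_sl \<S> S')"
    then obtain U where "U \<in> closed_sets S'" "a = enc \<S> S' U" by auto
    then show "h a = box_hom \<S> S S' M a" by (simp add: box_hom_enc[OF S'] box enc_k)
  qed
  ultimately show "h \<in> box_hom \<S> S S' ` compatible_meet_rel S S'" by blast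
qed

text \<open>Identities are preserved by \<open>box_dual_spec\<close> and composites by
  \<open>box_star\<close>, which reverses their order; hence the opposite category.\<close>

lemma cat_functor_closed_sl:
  "cat_functor (MoSsp \<S> :: ('b mos_space, ('b \<times> 'b) set) cat) (op_cat (MoSL \<S>))
    (closed_sl \<S>) (box_hom \<S>)"
proof
  fix A B E :: "'b mos_space" and f g
  assume A: "A \<in> Obj (MoSsp \<S>)"
  interpret A: small_MoS_space \<S> A by (rule small_MoS_spaceI[OF A])
  show "closed_sl \<S> A \<in> Obj (op_cat (MoSL \<S>))"
    by (simp add: op_cat_def MoSL_def A.modal_semilattice_closed_sl A.enc_image)
  show "box_hom \<S> A A (Ident (MoSsp \<S>) A) = Ident (op_cat (MoSL \<S>)) (closed_sl \<S> A)"
    unfolding op_cat_def MoSL_def MoSsp_def cat.simps box_hom_def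
    by (rule restrict_ext) (auto simp: A.box_dual_spec)
  assume B: "B \<in> Obj (MoSsp \<S>)" and f: "f \<in> Hom (MoSsp \<S>) A B"
  interpret B: small_MoS_space \<S> B by (rule small_MoS_spaceI[OF B])
  have f': "f \<in> compatible_meet_rel A B" using f by (simp add: MoSsp_def)
  show "box_hom \<S> A B f \<in> Hom (op_cat (MoSL \<S>)) (closed_sl \<S> A) (closed_sl \<S> B)"
    unfolding op_cat_def MoSL_def cat.simps
    by (rule box_hom_modal_hom[OF A.small_MoS_space_axioms B.small_MoS_space_axioms f'])
  assume E: "E \<in> Obj (MoSsp \<S>)" and g: "g \<in> Hom (MoSsp \<S>) B E"
  interpret E: small_MoS_space \<S> E by (rule small_MoS_spaceI[OF E])
  have g': "g \<in> compatible_meet_rel B E" using g by (simp add: MoSsp_def)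
  note fr = compatible_meet_relD(1)[OF A.MoS B.MoS f'] and gr = compatible_meet_relD(1)[OF B.MoS E.MoS g']
  show "box_hom \<S> A E (Comp (MoSsp \<S>) A B E g f) =
      Comp (op_cat (MoSL \<S>)) (closed_sl \<S> A) (closed_sl \<S> B) (closed_sl \<S> E)
        (box_hom \<S> B E g) (box_hom \<S> A B f)"
    unfolding op_cat_def MoSL_def MoSsp_def cat.simps
  proof (rule extensionalityI[of _ "carr (closed_sl \<S> E)"])
    fix a assume "a \<in> carr (closed_sl \<S> E)"
    then obtain U where U: "U \<in> closed_sets E" "a = enc \<S> E U" by auto
    then show "box_hom \<S> A E (star (pts A) (pts E) (subbase E) g f) a =
        compose (carr (closed_sl \<S> E)) (box_hom \<S> A B f) (box_hom \<S> B E g) a"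
      by (simp add: compose_eq box_hom_enc[OF E.small_MoS_space_axioms]
          box_hom_enc[OF B.small_MoS_space_axioms] box_in_SS[OF gr] box_star[OF gr fr])
  qed (simp_all add: box_hom_def compose_extensional)
qed

text \<open>Filters are subsets of \<open>carr L\<close>, so \<open>embed\<close> lets elements of
  \<open>'b\<close> label them as points. The modal operator is moved along \<open>\<phi>\<close> to
  the closed subbasic sets, where \<open>meet_relation_of_hom\<close> realizes it as a box operator.
  Then \<open>\<phi>\<close> followed by \<open>enc\<close> is an isomorphism onto
  \<open>closed_sl \<S> S\<close>.\<close>

lemma closed_sl_ess_surj:
  assumes L: "modal_semilattice L" "carr L \<in> \<S>" and embed: "Pow (carr L) \<lesssim> (UNIV :: 'b set)"
  shows "\<exists>S \<in> Obj (MoSsp \<S> :: ('b mos_space, ('b \<times> 'b) set) cat).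
    \<exists>f. cat_iso (MoSL \<S>) (closed_sl \<S> S) L f"
proof -
  interpret meet_sl L
    using L(1) by unfold_locales (simp add: modal_semilattice_def)
  obtain e :: "'a set \<Rightarrow> 'b" where e: "inj_on e (Pow (carr L))"
    using embed unfolding lepoll_def by blast
  define X where "X = e ` Collect irreducible_filter"
  define pt where "pt = inv_into (Collect irreducible_filter) e"
  have "inj_on e (Collect irreducible_filter)"
    using e by (rule inj_on_subset) (auto simp: irreducible_filter_def lfilter_def)
  then have "bij_betw pt X (Collect irreducible_filter)"
    unfolding pt_def X_def by (intro bij_betw_inv_into) (simp add: bij_betw_def)
  then interpret irreducible_filter_space L X pt by unfold_locales
  note L' = modal_semilatticeD[OF L(1)]
  define \<psi> where "\<psi> = inv_into (carr L) \<phi>"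
  have \<psi>_\<phi> [simp]: "\<psi> (\<phi> a) = a" if "a \<in> carr L" for a
    unfolding \<psi>_def using inj_on_\<phi> that by simp
  define d where "d U = \<phi> (dia L (\<psi> U))" for U
  have d: "d U \<in> SS X K" if "U \<in> SS X K" for U
    using that L'(3) by (auto simp: d_def SS_eq)
  have d_X: "d X = X"
    using \<psi>_\<phi>[OF L'(1)] L'(4) by (simp add: d_def \<phi>_one)
  have d_Int: "d (U \<inter> V) = d U \<inter> d V" if UV: "U \<in> SS X K" "V \<in> SS X K" for U V
  proof -
    obtain a b where ab: "a \<in> carr L" "U = \<phi> a" "b \<in> carr L" "V = \<phi> b"
      using UV unfolding SS_eq by (elim imageE)
    then have "d (U \<inter> V) = \<phi> (dia L (meet L a b))"
      by (simp add: d_def \<phi>_meet[symmetric])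
    then show ?thesis using ab L'(3,5) by (simp add: d_def \<phi>_meet)
  qed
  obtain T where T: "meet_relation X K X K T" "\<And>U. U \<in> SS X K \<Longrightarrow> box X T U = d U"
    using meet_relation_of_hom[of X K X K d, OF S_space_axioms S_space_axioms d d_X d_Int] by metis
  define S where "S = \<lparr>pts = X, subbase = K, rel = T\<rparr>"
  have S_sel [simp]: "pts S = X" "subbase S = K" "rel S = T" by (simp_all add: S_def)
  \<comment> \<open>The bijection \<open>\<phi>\<close> provides the smallness condition on objects
    of \<open>MoSsp \<S>\<close>, with \<open>carr L\<close> as the member of
    \<open>\<S>\<close>.\<close>
  have "bij_betw \<phi> (carr L) (SS X K)" using inj_on_\<phi> by (simp add: bij_betw_def SS_eq)
  then have "carr L \<approx> SS X K" unfolding eqpoll_def by (rule exI[of _ \<phi>])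
  then have "SS X K \<approx> carr L" by (rule eqpoll_sym)
  then have S: "S \<in> Obj (MoSsp \<S>)"
    using T(1) S_space_axioms L(2) by (auto simp: MoSsp_def MoS_space_def)
  interpret S: small_MoS_space \<S> S by (rule small_MoS_spaceI[OF S])
  have \<phi>_SS [simp]: "\<phi> a \<in> SS X K" if "a \<in> carr L" for a using that by (simp add: SS_eq)
  note [simp] = S.dec_enc[unfolded S_sel] S.enc_eq_iff[unfolded S_sel]
  define h where "h = (\<lambda>a\<in>carr L. enc \<S> S (\<phi> a))"
  have "h \<in> modal_hom L (closed_sl \<S> S)"
    unfolding modal_hom_def h_def using L' by (auto simp: \<phi>_one \<phi>_meet T(2) d_def)
  moreover have "bij_betw h (carr L) (carr (closed_sl \<S> S))"
    using inj_on_\<phi> by (auto simp: bij_betw_def inj_on_def h_def SS_eq image_image)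
  ultimately show ?thesis
    using S cat_iso_MoSL[OF L(1)] by blast
qed

text \<open>The hypothesis on power sets enters through \<open>closed_sl_ess_surj\<close>: it
  guarantees enough elements of \<open>'b\<close> to serve as points of the dual spaces.\<close>

theorem theorem3p1:
  fixes \<S> :: "'a set set"
  assumes "\<forall>A\<in>\<S>. Pow A \<lesssim> (UNIV :: 'b set)"
  shows "dually_equivalent (MoSL \<S>) (MoSsp \<S> :: ('b mos_space, ('b \<times> 'b) set) cat)"
  unfolding dually_equivalent_def
proof (intro conjI category_MoSL equivalent_cats_if_fully_faithful_ess_surj)
  show "category (op_cat (MoSL \<S>))"
    by (rule category_op_cat[OF category_MoSL])
  show "category (MoSsp \<S> :: ('b mos_space, ('b \<times> 'b) set) cat)"
    by (rule category_MoSsp)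
  show "cat_functor (MoSsp \<S> :: ('b mos_space, ('b \<times> 'b) set) cat) (op_cat (MoSL \<S>))
      (closed_sl \<S>) (box_hom \<S>)"
    by (rule cat_functor_closed_sl)
  show "bij_betw (box_hom \<S> X Y) (Hom (MoSsp \<S>) X Y)
      (Hom (op_cat (MoSL \<S>)) (closed_sl \<S> X) (closed_sl \<S> Y))"
    if "X \<in> Obj (MoSsp \<S>)" "Y \<in> Obj (MoSsp \<S>)" for X Y :: "'b mos_space"
    using bij_betw_box_hom[OF that[THEN small_MoS_spaceI]]
    by (simp add: op_cat_def MoSL_def MoSsp_def)
  show "\<exists>X \<in> Obj (MoSsp \<S> :: ('b mos_space, ('b \<times> 'b) set) cat).
      \<exists>f. cat_iso (op_cat (MoSL \<S>)) A (closed_sl \<S> X) f"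
    if "A \<in> Obj (op_cat (MoSL \<S>))" for A
    unfolding cat_iso_op_cat
    using that assms by (intro closed_sl_ess_surj) (simp_all add: op_cat_def MoSL_def)
qed

end
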